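(* Suppose that $1<p<\infty$, $\frac1p+\frac1{p'}=1$, and let $g$ be an analytic function in $\mathbb{D}$. Then: (i) $I_g$ maps $B^p$ into $\mathcal{B}$ if and only if $g\in H^\infty$. (ii) $M_g$ maps $B^p$ into $\mathcal{B}$ if and only if $g\in H^\infty\cap\mathcal{B}_{\log,1/p'}$. (iii) $T_g$ maps $B^p$ into $\mathcal{B}$ if and only if $g\in\mathcal{B}_{\log,1/p'}$.
   Context: $\mathbb{D}$ is the open unit disc in $\mathbb{C}$ and $dA$ is the normalized Lebesgue area measure on $\mathbb{D}$. $H^\infty$ is the space of bounded analytic functions in $\mathbb{D}$. For $1<p<\infty$, the Besov space $B^p$ is the space of all analytic $f$ in $\mathbb{D}$ with $\int_{\mathbb{D}}(1-|z|)^{p-2}|f'(z)|^p\,dA(z)<\infty$. The Bloch space $\mathcal{B}$ is the space of all analytic $f$ in $\mathbb{D}$ with $\sup_{z\in\mathbb{D}}(1-|z|^2)|f'(z)|<\infty$. For $\alpha>0$, the $\alpha$-logarithmic Bloch space $\mathcal{B}_{\log,\alpha}$ is the space of all analytic $f$ in $\mathbb{D}$ with $\sup_{z\in\mathbb{D}}(1-|z|^2)\left(\log\frac{2}{1-|z|^2}\right)^\alpha|f'(z)|<\infty$. For $g$ and $f$ analytic in $\mathbb{D}$ and $z\in\mathbb{D}$: $T_g(f)(z)=\int_0^z g'(\xi)f(\xi)\,d\xi$, $I_g(f)(z)=\int_0^z g(\xi)f'(\xi)\,d\xi$, $M_g(f)(z)=g(z)f(z)$. An operator $T$ maps $X$ into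 $Y$ if $T(X)\subset Y$. *)

theory Defs
  imports "HOL-Complex_Analysis.Complex_Analysis"
begin

text \<open>
  Functions on the disc are total functions of type \<open>complex \<Rightarrow> complex\<close>, of which only the
  values on the disc matter: at points of the (open) disc, \<open>deriv\<close> depends only on those values,
  and none of the spaces below constrains a function outside the disc.
\<close>

abbreviation unit_disc :: "complex set" (\<open>\<D>\<close>) where
  "\<D> \<equiv> ball 0 1"

text \<open>The disc has Lebesgue area \<open>pi\<close>, so this has total mass 1.\<close>

definition area_measure :: "complex measure" where
  "area_measure = scale_measure (ennreal (1 / pi)) (restrict_space lborel \<D>)"

definition H_infinity :: "(complex \<Rightarrow> complex) set" where
  "H_infinity = {f. f holomorphic_on \<D> \<and> bounded (f ` \<D>)}"

definition Besov :: "real \<Rightarrow> (complex \<Rightarrow> complex) set" where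
  "Besov p = {f. f holomorphic_on \<D> \<and>
     (\<integral>\<^sup>+ z. ennreal ((1 - norm z) powr (p - 2) * norm (deriv f z) powr p) \<partial>area_measure) < \<infinity>}"

definition Bloch :: "(complex \<Rightarrow> complex) set" where
  "Bloch = {f. f holomorphic_on \<D> \<and>
     bdd_above ((\<lambda>z. (1 - (norm z)\<^sup>2) * norm (deriv f z)) ` \<D>)}"

definition Bloch_log :: "real \<Rightarrow> (complex \<Rightarrow> complex) set" where
  "Bloch_log \<alpha> = {f. f holomorphic_on \<D> \<and>
     bdd_above ((\<lambda>z. (1 - (norm z)\<^sup>2) * ln (2 / (1 - (norm z)\<^sup>2)) powr \<alpha> * norm (deriv f z)) ` \<D>)}"

text \<open>
  The integrands are analytic in the disc, so the integral from 0 to \<open>z\<close> does not depend on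
  the path; the segment is used.
\<close>

definition T_op :: "(complex \<Rightarrow> complex) \<Rightarrow> (complex \<Rightarrow> complex) \<Rightarrow> complex \<Rightarrow> complex" where
  "T_op g f z = contour_integral (linepath 0 z) (\<lambda>\<xi>. deriv g \<xi> * f \<xi>)"

definition I_op :: "(complex \<Rightarrow> complex) \<Rightarrow> (complex \<Rightarrow> complex) \<Rightarrow> complex \<Rightarrow> complex" where
  "I_op g f z = contour_integral (linepath 0 z) (\<lambda>\<xi>. g \<xi> * deriv f \<xi>)"

definition M_op :: "(complex \<Rightarrow> complex) \<Rightarrow> (complex \<Rightarrow> complex) \<Rightarrow> complex \<Rightarrow> complex" where
  "M_op g f z = g z * f z"

end

(*
For f in B^p the submean value property of |f'|^p bounds (1-|z|)^p |f'(z)|^p by the Besov integral over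
the disc of radius (1-|z|)/2 about z; hence B^p lies in the Bloch space, and summing along a radius over
dyadic annuli gives |f(z)| <= C (log 2/(1-|z|^2))^(1/p').  These two facts give sufficiency.

For necessity, the test functions are the Moebius maps phi_b, whose B^p norms are bounded by conformal
invariance, and f_b(z) = L_b^(-1/p) log(2/(1 - conj(b) z)) with L_b = log(2/(1-|b|^2)).  The latter have
bounded norms because 1/|1 - conj(b) z| is dominated by the largest of the |phi_a'(z)| with a running
through the roughly L_b points of moduli 1 - 2^(-k) on the radius of b.  A gliding hump argument shows
that an operator mapping B^p into the Bloch space is uniformly bounded on each of these families; one
evaluates at z = b.  Since phi_b(b) = 0, the same test applied to M_g yields g in H^infty, so that I_g
and hence T_g also map into the Bloch space.
*)

theory Submission
  imports Defs
begin

section \<open>Holomorphic substitution in area integrals\<close>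

no_notation fps_nth (infixl "$" 75)

text \<open>No norm is ever put on \<open>Besov p\<close>. The uniform boundedness argument uses one
  closure property only: a series with coefficients of modulus \<open>(1/3) ^ k\<close> stays in the
  space if its terms have bounded Besov integrals and are uniformly bounded on smaller discs
  (\<open>Besov_series\<close>). The triangle inequality in L^p is avoided as well: at each point
  one dominant term of the series controls the whole sum, so \<open>p\<close>-th powers can be
  integrated term by term. Such replacements cost constants only. The exponent \<open>p - 2\<close>
  of the weight changes sign at \<open>p = 2\<close>, so weights are compared only up to factors
  \<open>2 powr \<bar>p - 2\<bar>\<close>, which serve both signs at once. A direct estimate of the
  logarithmic test functions would need the exact growth of the integral of (1-|z|)^(p-2) / |1 -
  conj(b) z|^p. Comparison with Moebius maps turns that growth into counting: each map contributes a
  bounded amount, the number of maps is O(L_b), and the factor L_b^(-1/p), raised to the power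
  \<open>p\<close>, cancels that number.\<close>

definition v2c :: "real^2 \<Rightarrow> complex" where "v2c v = Complex (v$1) (v$2)"
definition c2v :: "complex \<Rightarrow> real^2" where "c2v z = vector [Re z, Im z]"

lemma c2v_v2c [simp]: "c2v (v2c v) = v"
  by (simp add: v2c_def c2v_def vec_eq_iff forall_2)

lemma v2c_c2v [simp]: "v2c (c2v z) = z"
  by (simp add: v2c_def c2v_def complex_eq_iff)

lemma bounded_linear_v2c: "bounded_linear v2c"
  unfolding linear_conv_bounded_linear[symmetric]
  by (auto simp: linear_iff v2c_def complex_eq_iff)

lemma bounded_linear_c2v: "bounded_linear c2v"
  unfolding linear_conv_bounded_linear[symmetric]
  by (auto simp: linear_iff c2v_def vec_eq_iff forall_2)

text \<open>The change of variables theorem used below lives on \<open>real^'n\<close>, hence the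
  detour through \<open>real^2\<close>. Lebesgue measure is determined by its values on boxes, and
  \<open>v2c\<close> pulls a box back to a box with the same sides.\<close>

lemma lborel_complex_eq: "lborel = distr lborel borel v2c"
proof (rule lborel_eqI)
  have m: "v2c \<in> borel_measurable borel"
    using bounded_linear_v2c by (intro borel_measurable_continuous_onI linear_continuous_on)
  have B: "(Basis :: (real^2) set) = {axis 1 1, axis 2 1}"
    unfolding Basis_vec_def by (auto simp: UNIV_2)
  have axis_ne: "axis 1 (1::real) \<noteq> (axis 2 1 :: real^2)" by (simp add: axis_eq_axis)
  fix l u :: complex
  assume *: "\<And>b. b \<in> Basis \<Longrightarrow> l \<bullet> b \<le> u \<bullet> b"
  have eq: "v2c -` box l u = box (c2v l) (c2v u)"
    unfolding box_def B by (auto simp: v2c_def c2v_def Basis_complex_def inner_complex_def inner_axis)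
  have "emeasure (distr lborel borel v2c) (box l u) = emeasure lborel (box (c2v l) (c2v u))"
    using m by (subst emeasure_distr) (auto simp: eq)
  also have "\<dots> = (\<Prod>b\<in>Basis. (c2v u - c2v l) \<bullet> b)"
  proof (rule emeasure_lborel_box)
    fix b :: "real^2" assume "b \<in> Basis"
    then consider "b = axis 1 1" | "b = axis 2 1" unfolding B by blast
    then show "c2v l \<bullet> b \<le> c2v u \<bullet> b"
      using *[of 1] *[of \<i>]
      by cases (simp_all add: inner_axis c2v_def Basis_complex_def inner_complex_def)
  qed
  also have "(\<Prod>b\<in>Basis. (c2v u - c2v l) \<bullet> b) = (\<Prod>b\<in>Basis. (u - l) \<bullet> b)"
    using axis_ne unfolding B by (simp add: Basis_complex_def inner_complex_def inner_axis c2v_def)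
  finally show "emeasure (distr lborel borel v2c) (box l u) = (\<Prod>b\<in>Basis. (u - l) \<bullet> b)" .
qed simp

lemma nn_integral_lborel_complex:
  assumes "f \<in> borel_measurable borel"
  shows "(\<integral>\<^sup>+z. f z \<partial>lborel) = (\<integral>\<^sup>+v. f (v2c v) \<partial>lborel)"
proof -
  have m: "v2c \<in> borel_measurable borel"
    using bounded_linear_v2c by (intro borel_measurable_continuous_onI linear_continuous_on)
  show ?thesis
  using m assms by (subst lborel_complex_eq) (subst nn_integral_distr, auto)
qed

text \<open>Multiplication by \<open>d = x + iy\<close> has the real matrix with rows (x, -y) and
  (y, x), whose determinant is x^2 + y^2.\<close>

lemma det_complex_mult:
  "det (matrix (\<lambda>v. c2v (d * v2c v))) = (norm d)\<^sup>2"
  unfolding cmod_power2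
  by (simp add: det_2 matrix_def v2c_def c2v_def axis_def power2_eq_square)

text \<open>The real Jacobian of a holomorphic map is the square of |phi'|. Finiteness of the
  integral over the image gives the absolute integrability that the change of variables theorem
  speaks of; since \<open>F\<close> is nonnegative, its result translates back to nonnegative
  integrals.\<close>

lemma nn_integral_holomorphic_substitution:
  fixes F :: "complex \<Rightarrow> real"
  assumes S: "open S" and hol: "\<phi> holomorphic_on S" and inj: "inj_on \<phi> S"
    and F: "F \<in> borel_measurable borel" "\<And>w. 0 \<le> F w"
    and fin: "(\<integral>\<^sup>+w. ennreal (indicator (\<phi> ` S) w * F w) \<partial>lborel) < \<infinity>"
  shows "(\<integral>\<^sup>+z. ennreal (indicator S z * ((norm (deriv \<phi> z))\<^sup>2 * F (\<phi> z))) \<partial>lborel)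
       = (\<integral>\<^sup>+w. ennreal (indicator (\<phi> ` S) w * F w) \<partial>lborel)"
proof -
  let ?S = "v2c -` S"
  let ?g = "\<lambda>v. c2v (\<phi> (v2c v))"
  let ?g' = "\<lambda>v h. c2v (deriv \<phi> (v2c v) * v2c h)"
  \<comment> \<open>The theorem treats vector-valued integrands, so the real value is packed into
    \<open>real^1\<close>.\<close>
  let ?F = "\<lambda>v. vec (F (v2c v)) :: real^1"
  have cont: "continuous_on A v2c" for A
    using bounded_linear_v2c by (intro linear_continuous_on)
  have mv: "v2c \<in> borel_measurable borel"
    using cont by (intro borel_measurable_continuous_onI)
  have mc: "c2v \<in> borel_measurable borel"
    using bounded_linear_c2v by (intro borel_measurable_continuous_onI linear_continuous_on)
  have oS: "open ?S" using S cont[of UNIV] by (rule open_vimage)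
  have oT: "open (\<phi> ` S)" using hol S inj by (rule open_mapping_thm3)
  have T: "?g ` ?S = v2c -` (\<phi> ` S)"
  proof (intro equalityI subsetI)
    fix x assume "x \<in> v2c -` (\<phi> ` S)"
    then obtain y where "y \<in> S" "v2c x = \<phi> y" by auto
    then have "x = ?g (c2v y)" "c2v y \<in> ?S" by (simp_all flip: \<open>v2c x = \<phi> y\<close>)
    then show "x \<in> ?g ` ?S" by (rule image_eqI)
  qed auto
  have oTv: "open (v2c -` (\<phi> ` S))" using oT cont[of UNIV] by (rule open_vimage)
  have der: "(?g has_derivative ?g' x) (at x within ?S)" if "x \<in> ?S" for x
  proof -
    have "(\<phi> has_field_derivative deriv \<phi> (v2c x)) (at (v2c x))"
      using hol S that by (auto intro: holomorphic_derivI)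
    then have "(\<phi> has_derivative (*) (deriv \<phi> (v2c x))) (at (v2c x))"
      by (simp add: has_field_derivative_def)
    from has_derivative_compose[OF bounded_linear_imp_has_derivative[OF bounded_linear_v2c] this]
    have "((\<lambda>x. \<phi> (v2c x)) has_derivative (\<lambda>h. deriv \<phi> (v2c x) * v2c h)) (at x within ?S)" .
    from bounded_linear.has_derivative[OF bounded_linear_c2v this] show ?thesis .
  qed
  have injv: "inj_on ?g ?S"
    using inj by (auto simp: inj_on_def) (metis c2v_v2c v2c_c2v)
  have "?S \<in> sets lebesgue" using oS by (simp add: borel_open)
  note cov = has_absolute_integral_change_of_variables[OF this der injv, of ?F]
  have mF0: "(\<lambda>w. indicator (\<phi> ` S) w * F w) \<in> borel_measurable borel"
    using F(1) oT by (intro borel_measurable_times borel_measurable_indicator) simp_all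
  then have eqT: "(\<integral>\<^sup>+w. ennreal (indicator (\<phi> ` S) w * F w) \<partial>lborel)
      = (\<integral>\<^sup>+v. ennreal (indicator (?g ` ?S) v * F (v2c v)) \<partial>lborel)"
    unfolding T by (subst nn_integral_lborel_complex) (auto simp: indicator_def)
  have mF: "(\<lambda>v. indicator (?g ` ?S) v * F (v2c v)) \<in> borel_measurable borel"
    unfolding T using measurable_compose[OF mv F(1)] oTv by (intro borel_measurable_times borel_measurable_indicator) simp_all
  define N where "N = (\<integral>\<^sup>+v. ennreal (indicator (?g ` ?S) v * F (v2c v)) \<partial>lborel)"
  obtain r where "0 \<le> r" "N = ennreal r"
    using fin unfolding eqT N_def[symmetric] by (cases N) auto
  then have r: "0 \<le> r" "(\<integral>\<^sup>+v. ennreal (indicator (?g ` ?S) v * F (v2c v)) \<partial>lborel) = ennreal r"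
    by (simp_all add: N_def)
  have "((\<lambda>v. indicator (?g ` ?S) v * F (v2c v)) has_integral r) UNIV"
    by (rule nn_integral_has_integral[OF mF _ r(2,1)]) (auto simp: F)
  also have "(\<lambda>v. indicator (?g ` ?S) v * F (v2c v)) = (\<lambda>v. if v \<in> ?g ` ?S then F (v2c v) else 0)"
    by (auto simp: indicator_def)
  finally have hi: "((\<lambda>v. F (v2c v)) has_integral r) (?g ` ?S)"
    by (simp only: has_integral_restrict_UNIV)
  then have ai: "(\<lambda>v. F (v2c v)) absolutely_integrable_on (?g ` ?S)"
    using F(2) by (intro nonnegative_absolutely_integrable_1) (auto simp: integrable_on_def)
  have "?F absolutely_integrable_on (?g ` ?S) \<and> integral (?g ` ?S) ?F = vec r"
    using ai hi by (auto simp: absolutely_integrable_on_1_iff integral_on_1_eq integral_unique)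
  then have "(\<lambda>x. \<bar>det (matrix (?g' x))\<bar> *\<^sub>R ?F (?g x)) absolutely_integrable_on ?S \<and>
     integral ?S (\<lambda>x. \<bar>det (matrix (?g' x))\<bar> *\<^sub>R ?F (?g x)) = vec r"
    using cov by blast
  then have a2: "(\<lambda>x. (norm (deriv \<phi> (v2c x)))\<^sup>2 * F (\<phi> (v2c x))) absolutely_integrable_on ?S"
     and a3: "integral ?S (\<lambda>x. (norm (deriv \<phi> (v2c x)))\<^sup>2 * F (\<phi> (v2c x))) = r"
    by (auto simp: absolutely_integrable_on_1_iff integral_on_1_eq det_complex_mult vec_eq_iff)
  have "((\<lambda>x. (norm (deriv \<phi> (v2c x)))\<^sup>2 * F (\<phi> (v2c x))) has_integral r) ?S"
    using set_lebesgue_integral_eq_integral(1)[OF a2] a3 by (simp add: has_integral_iff)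
  then have "(\<integral>\<^sup>+v. ennreal (indicator ?S v * ((norm (deriv \<phi> (v2c v)))\<^sup>2 * F (\<phi> (v2c v)))) \<partial>lborel) = r"
    by (intro nn_integral_has_integral_lebesgue) (auto simp: F)
  also have "(\<integral>\<^sup>+v. ennreal (indicator ?S v * ((norm (deriv \<phi> (v2c v)))\<^sup>2 * F (\<phi> (v2c v)))) \<partial>lborel)
     = (\<integral>\<^sup>+z. ennreal (indicator S z * ((norm (deriv \<phi> z))\<^sup>2 * F (\<phi> z))) \<partial>lborel)"
  proof (subst nn_integral_lborel_complex)
    \<comment> \<open>Outside \<open>S\<close> the map is arbitrary. Cutting \<open>\<phi>\<close>
      and its derivative off to 0 there gives measurable functions and leaves the integrand
      unchanged under the indicator.\<close>
    have [measurable]: "S \<in> sets borel" using S by simp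
    note F(1)[measurable]
    have [measurable]: "(\<lambda>z. indicator S z *\<^sub>R \<phi> z) \<in> borel_measurable borel"
      using S hol by (intro borel_measurable_continuous_on_indicator holomorphic_on_imp_continuous_on) auto
    have [measurable]: "(\<lambda>z. indicator S z *\<^sub>R deriv \<phi> z) \<in> borel_measurable borel"
      using S hol by (intro borel_measurable_continuous_on_indicator holomorphic_on_imp_continuous_on holomorphic_deriv) auto
    have "(\<lambda>z. ennreal (indicator S z * ((norm (indicator S z *\<^sub>R deriv \<phi> z))\<^sup>2 * F (indicator S z *\<^sub>R \<phi> z)))) \<in> borel_measurable borel"
      by measurable
    also have "(\<lambda>z. ennreal (indicator S z * ((norm (indicator S z *\<^sub>R deriv \<phi> z))\<^sup>2 * F (indicator S z *\<^sub>R \<phi> z)))) 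
      = (\<lambda>z. ennreal (indicator S z * ((norm (deriv \<phi> z))\<^sup>2 * F (\<phi> z))))"
      by (auto simp: indicator_def)
    finally show "\<dots> \<in> borel_measurable borel" .
  qed (auto simp: indicator_def)
  finally show ?thesis using eqT r by simp
qed

section \<open>Submean value properties\<close>

text \<open>Applied with a suitable \<open>l\<close>, this does the work of the inequalities of Jensen and Hoelder.\<close>

lemma powr_splitting:
  fixes x l p :: real
  assumes "0 \<le> x" "0 < l" "1 \<le> p"
  shows "x \<le> l powr (1 - p) * x powr p + l"
proof (cases "x \<le> l")
  case True
  then show ?thesis by (simp add: add_increasing)
next
  case False
  then have "1 \<le> (x / l) powr (p - 1)"
    using assms by (intro ge_one_powr_ge_zero) auto
  then have "x * 1 \<le> x * (x / l) powr (p - 1)"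
    using assms by (intro mult_left_mono) auto
  also have "\<dots> = l powr (1 - p) * x powr p"
    using assms False by (simp add: powr_divide powr_diff field_simps)
  finally show ?thesis using assms by simp
qed

lemma holomorphic_circle_mean:
  assumes "h holomorphic_on ball 0 R" "1 < R"
  shows "((\<lambda>t. h (exp (2 * of_real pi * \<i> * of_real t))) has_integral h 0) {0..1}"
proof -
  have "cball 0 1 \<subseteq> ball (0::complex) R" using assms by auto
  then have "h holomorphic_on cball 0 1" using assms holomorphic_on_subset by blast
  from Cauchy_integral_circlepath_simple[OF this, of 0]
  have "((\<lambda>u. h u / u) has_contour_integral (2 * of_real pi * \<i> * h 0)) (circlepath 0 1)" by simp
  then have "((\<lambda>t. h (exp (2 * of_real pi * \<i> * of_real t)) * (2 * of_real pi * \<i>)) has_integral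
      (2 * of_real pi * \<i> * h 0)) {0..1}"
    unfolding has_contour_integral_def
    \<comment> \<open>The tangent vector at a point \<open>u\<close> of the unit circle is 2 pi i u,
      which cancels the 1/u of the Cauchy kernel.\<close>
    by (rule has_integral_eq[rotated]) (simp add: vector_derivative_circlepath01, simp add: circlepath)
  from has_integral_mult_left[OF this, of "1 / (2 * of_real pi * \<i>)"] show ?thesis by simp
qed

text \<open>Splitting at level \<open>c\<close>, half of |h(0)|, turns the mean value property into
  2c \<le> c^(1-p) J + c, where J is the mean of |h|^p. One \<open>c\<close> is absorbed on the
  left, which leaves c^p \<le> J; this is the origin of the factor 1/2 in the statement.\<close>

lemma holomorphic_powr_circle_submean:
  fixes p :: real
  assumes h: "h holomorphic_on ball 0 R" and R: "1 < R" and p: "1 \<le> p"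
  shows "ennreal ((norm (h 0) / 2) powr p)
    \<le> (\<integral>\<^sup>+t. ennreal (indicator {0..1} t * norm (h (exp (2 * of_real pi * \<i> * of_real t))) powr p) \<partial>lborel)"
proof (cases "h 0 = 0")
  case False
  define c where "c = norm (h 0) / 2"
  have c: "c > 0" using False by (simp add: c_def)
  let ?e = "\<lambda>t::real. exp (2 * of_real pi * \<i> * of_real t)"
  have "continuous_on {0..1} (\<lambda>t. h (?e t))"
    by (rule continuous_on_compose2[OF holomorphic_on_imp_continuous_on[OF h]])
       (use R in \<open>auto intro!: continuous_intros\<close>)
  then have "continuous_on {0..1} (\<lambda>t. norm (h (?e t)) powr p)"
    using p by (intro continuous_on_powr' continuous_intros) auto
  then obtain J where J: "((\<lambda>t. norm (h (?e t)) powr p) has_integral J) {0..1}"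
    using integrable_continuous_interval by blast
  note H = holomorphic_circle_mean[OF h R]
  have "((\<lambda>t. c powr (1 - p) * norm (h (?e t)) powr p + c) has_integral (c powr (1 - p) * J + c)) {0..1}"
    using has_integral_const_real[of c 0 1] by (intro has_integral_add has_integral_mult_right J) simp
  then have int: "(\<lambda>t. c powr (1 - p) * norm (h (?e t)) powr p + c) integrable_on {0..1}"
    and eq: "integral {0..1} (\<lambda>t. c powr (1 - p) * norm (h (?e t)) powr p + c) = c powr (1 - p) * J + c"
    by (simp_all add: has_integral_iff)
  have "norm (integral {0..1} (\<lambda>t. h (?e t))) \<le> c powr (1 - p) * J + c"
    unfolding eq[symmetric]
    by (rule integral_norm_bound_integral[OF _ int powr_splitting[OF norm_ge_zero c p]])
       (use H in \<open>simp add: has_integral_iff\<close>)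
  then have "norm (h 0) \<le> c powr (1 - p) * J + c"
    using integral_unique[OF H] by simp
  then have "c powr p \<le> c powr p * (c powr (1 - p) * J / c)"
    using c by (auto simp: c_def field_simps)
  also have "\<dots> = (c powr p * c powr (1 - p)) * J / c" by simp
  also have "\<dots> = J" using c by (simp flip: powr_add)
  finally have "c powr p \<le> J" .
  moreover have "(\<integral>\<^sup>+t. ennreal (indicator {0..1} t * norm (h (?e t)) powr p) \<partial>lborel) = J"
    by (rule nn_integral_has_integral_lebesgue[OF _ J]) auto
  ultimately show ?thesis by (simp add: c_def ennreal_leI)
qed (use p in auto)

lemma emeasure_ball_complex:
  assumes "0 \<le> r"
  shows "emeasure lborel (ball (c::complex) r) = ennreal (pi * r\<^sup>2)"
  using assms by (simp add: emeasure_ball unit_ball_vol_2 ennreal_mult' ennreal_power)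

lemma rotate_ball:
  fixes z e :: complex
  assumes "norm e = 1"
  shows "(\<lambda>w. z + e * (w - z)) ` ball z r = ball z r"
proof (intro equalityI subsetI)
  fix y assume "y \<in> ball z r"
  then have "z + (y - z) / e \<in> ball z r" "y = z + e * ((z + (y - z) / e) - z)"
    using assms by (auto simp: dist_norm norm_divide norm_minus_commute)
  then show "y \<in> (\<lambda>w. z + e * (w - z)) ` ball z r" by (rule rev_image_eqI)
qed (use assms in \<open>auto simp: dist_norm norm_mult norm_minus_commute\<close>)

text \<open>Polar coordinates are replaced by averaging over rotations. The circle inequality is
  applied on the circle about \<open>z\<close> through each \<open>w\<close> of the ball and
  integrated over \<open>w\<close>. After Fubini the inner integral, for a fixed rotation, is the
  integral of |h|^p over the ball, because the rotation maps the ball onto itself with Jacobian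
  1.\<close>

lemma holomorphic_powr_area_submean:
  fixes p :: real
  assumes h: "h holomorphic_on ball z r" and r: "0 \<le> r" and p: "1 \<le> p"
  shows "ennreal ((norm (h z) / 2) powr p * (pi * r\<^sup>2))
    \<le> (\<integral>\<^sup>+w. ennreal (indicator (ball z r) w * norm (h w) powr p) \<partial>lborel)" (is "?l \<le> ?I")
proof (cases "?I < \<infinity>")
  case True
  define F where "F w = indicator (ball z r) w * norm (h w) powr p" for w
  let ?e = "\<lambda>t::real. exp (2 * of_real pi * \<i> * of_real t)"
  have "(\<lambda>w. indicator (ball z r) w *\<^sub>R h w) \<in> borel_measurable borel"
    using h by (intro borel_measurable_continuous_on_indicator holomorphic_on_imp_continuous_on) auto
  then have "(\<lambda>w. norm (indicator (ball z r) w *\<^sub>R h w) powr p) \<in> borel_measurable borel"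
    by measurable
  also have "(\<lambda>w. norm (indicator (ball z r) w *\<^sub>R h w) powr p) = F"
    using p by (auto simp: F_def indicator_def fun_eq_iff)
  finally have mF [measurable]: "F \<in> borel_measurable borel" .
  have F_nonneg: "0 \<le> F w" for w by (simp add: F_def)
  have me [measurable]: "?e \<in> borel_measurable borel"
    by (intro borel_measurable_continuous_onI continuous_intros)
  have mb [measurable]: "ball z r \<in> sets borel" by simp
  define G where "G t w = ennreal (indicator {0..1} t * (indicator (ball z r) w * F (z + ?e t * (w - z))))" for t :: real and w
  have mG: "(\<lambda>(t, w). G t w) \<in> borel_measurable (lborel \<Otimes>\<^sub>M lborel)"
    unfolding G_def by measurable
  have I: "?I = (\<integral>\<^sup>+w. ennreal (indicator (ball z r) w * F w) \<partial>lborel)"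
    by (intro nn_integral_cong) (auto simp: F_def indicator_def)
  have rot: "(\<integral>\<^sup>+w. ennreal (indicator (ball z r) w * F (z + ?e t * (w - z))) \<partial>lborel) = ?I" for t
  proof -
    have e: "norm (?e t) = 1" by simp
    have d: "deriv (\<lambda>w. z + ?e t * (w - z)) w = ?e t" for w
      by (rule DERIV_imp_deriv) (auto intro!: derivative_eq_intros)
    have "(\<integral>\<^sup>+w. ennreal (indicator (ball z r) w * ((norm (deriv (\<lambda>w. z + ?e t * (w - z)) w))\<^sup>2 * F (z + ?e t * (w - z)))) \<partial>lborel)
      = (\<integral>\<^sup>+w. ennreal (indicator ((\<lambda>w. z + ?e t * (w - z)) ` ball z r) w * F w) \<partial>lborel)"
    proof (rule nn_integral_holomorphic_substitution)
      show "(\<integral>\<^sup>+ w. ennreal (indicator ((\<lambda>w. z + ?e t * (w - z)) ` ball z r) w * F w) \<partial>lborel) < \<infinity>"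
        using True unfolding rotate_ball[OF e] I .
    qed (auto simp: inj_on_def F_nonneg intro!: holomorphic_intros)
    then show ?thesis unfolding d e rotate_ball[OF e] I by simp
  qed
  have "?l = (\<integral>\<^sup>+w. ennreal ((norm (h z) / 2) powr p) * indicator (ball z r) w \<partial>lborel)"
    using r by (simp add: nn_integral_cmult_indicator emeasure_ball_complex ennreal_mult')
  also have "\<dots> \<le> (\<integral>\<^sup>+w. (\<integral>\<^sup>+t. G t w \<partial>lborel) \<partial>lborel)"
  proof (intro nn_integral_mono)
    fix w
    show "ennreal ((norm (h z) / 2) powr p) * indicator (ball z r) w \<le> (\<integral>\<^sup>+t. G t w \<partial>lborel)"
    proof (cases "w \<in> ball z r")
      case True
      \<comment> \<open>The largest radius for which z + zeta (w - z) stays in the ball; for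
        \<open>w = z\<close> any number above 1 would do.\<close>
      define R where "R = (if w = z then 2 else r / dist w z)"
      have R: "1 < R" using True by (auto simp: R_def dist_commute field_simps)
      have "norm (\<zeta> * (w - z)) < r" if "norm \<zeta> < R" for \<zeta>
      proof (cases "w = z")
        case False
        then have "norm \<zeta> * dist w z < r" using that by (simp add: R_def pos_less_divide_eq)
        then show ?thesis by (simp add: norm_mult dist_norm)
      qed (use True in auto)
      then have *: "(\<lambda>\<zeta>. z + \<zeta> * (w - z)) ` ball 0 R \<subseteq> ball z r"
        by (auto simp: dist_norm)
      have "(\<lambda>\<zeta>. z + \<zeta> * (w - z)) holomorphic_on ball 0 R"
        by (intro holomorphic_intros)
      from holomorphic_on_compose_gen[OF this h *]
      have "(\<lambda>\<zeta>. h (z + \<zeta> * (w - z))) holomorphic_on ball 0 R"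
        by (simp add: o_def)
      from holomorphic_powr_circle_submean[OF this R p]
      have "ennreal ((norm (h z) / 2) powr p) \<le> (\<integral>\<^sup>+t. ennreal (indicator {0..1} t * norm (h (z + ?e t * (w - z))) powr p) \<partial>lborel)"
        by simp
      also have "\<dots> = (\<integral>\<^sup>+t. G t w \<partial>lborel)"
      proof (intro nn_integral_cong)
        fix t :: real
        have "z + ?e t * (w - z) \<in> ball z r"
          using True by (simp add: dist_norm norm_mult norm_minus_commute)
        then show "ennreal (indicator {0..1} t * norm (h (z + ?e t * (w - z))) powr p) = G t w"
          using True by (simp add: G_def F_def)
      qed
      finally show ?thesis using True by simp
    qed simp
  qed
  also have "\<dots> = (\<integral>\<^sup>+t. (\<integral>\<^sup>+w. G t w \<partial>lborel) \<partial>lborel)"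
    using lborel_pair.Fubini'[OF mG] .
  also have "\<dots> = (\<integral>\<^sup>+t. ?I * indicator {0..1::real} t \<partial>lborel)"
  proof (intro nn_integral_cong)
    fix t :: real
    show "(\<integral>\<^sup>+w. G t w \<partial>lborel) = ?I * indicator {0..1} t"
    proof (cases "t \<in> {0..1}")
      case True
      have "G t = (\<lambda>w. ennreal (indicator (ball z r) w * F (z + ?e t * (w - z))))"
        using True by (simp add: G_def fun_eq_iff)
      then show ?thesis using True rot[of t] by simp
    qed (simp add: G_def)
  qed
  also have "\<dots> = ?I" by (simp add: nn_integral_cmult_indicator)
  finally show ?thesis .
qed (simp add: less_top[symmetric])

section \<open>Pointwise estimates in Besov spaces\<close>

text \<open>Extending the integrand by zero to the plane and dropping the factor
  \<open>1 / pi\<close> makes the substitution and submean lemmas, stated for \<open>lborel\<close>,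
  directly applicable. \<open>Besov_iff\<close> shows that this does not affect finiteness.\<close>

definition besov_density :: "real \<Rightarrow> (complex \<Rightarrow> complex) \<Rightarrow> complex \<Rightarrow> real" where
  "besov_density p f z = indicator \<D> z * ((1 - norm z) powr (p - 2) * norm (deriv f z) powr p)"

definition besov_int :: "real \<Rightarrow> (complex \<Rightarrow> complex) \<Rightarrow> ennreal" where
  "besov_int p f = (\<integral>\<^sup>+z. ennreal (besov_density p f z) \<partial>lborel)"

lemma besov_density_nonneg: "0 \<le> besov_density p f z"
  by (simp add: besov_density_def)

lemma borel_measurable_besov_density:
  assumes "f holomorphic_on \<D>"
  shows "besov_density p f \<in> borel_measurable borel"
proof -
  have [measurable]: "\<D> \<in> sets borel" by simp
  have [measurable]: "(\<lambda>z. indicator \<D> z *\<^sub>R deriv f z) \<in> borel_measurable borel"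
    using assms
    by (intro borel_measurable_continuous_on_indicator holomorphic_on_imp_continuous_on holomorphic_deriv) auto
  have "(\<lambda>z. indicator \<D> z * ((1 - norm z) powr (p - 2) * norm (indicator \<D> z *\<^sub>R deriv f z) powr p))
      \<in> borel_measurable borel"
    by measurable
  also have "(\<lambda>z. indicator \<D> z * ((1 - norm z) powr (p - 2) * norm (indicator \<D> z *\<^sub>R deriv f z) powr p))
      = besov_density p f"
    by (auto simp: besov_density_def indicator_def fun_eq_iff)
  finally show ?thesis .
qed

lemma Besov_iff: "f \<in> Besov p \<longleftrightarrow> f holomorphic_on \<D> \<and> besov_int p f < \<infinity>"
proof (cases "f holomorphic_on \<D>")
  case True
  let ?W = "\<lambda>z. ennreal ((1 - norm z) powr (p - 2) * norm (deriv f z) powr p)"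
  have eq: "(\<lambda>z. ?W z * indicator \<D> z) = (\<lambda>z. ennreal (besov_density p f z))"
    by (auto simp: besov_density_def indicator_def)
  have "?W \<in> borel_measurable (restrict_space lborel \<D>)"
    using borel_measurable_besov_density[OF True]
    by (subst borel_measurable_restrict_space_iff_ennreal) (simp_all add: eq)
  then have "nn_integral area_measure ?W = ennreal (1 / pi) * nn_integral (restrict_space lborel \<D>) ?W"
    unfolding area_measure_def by (rule nn_integral_scale_measure)
  also have "\<dots> = ennreal (1 / pi) * besov_int p f"
    by (subst nn_integral_restrict_space) (simp_all add: besov_int_def eq)
  finally have "nn_integral area_measure ?W = ennreal (1 / pi) * besov_int p f" .
  then show ?thesis
    using True by (auto simp: Besov_def ennreal_mult_less_top ennreal_mult_eq_top_iff less_top[symmetric])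
qed (simp add: Besov_def)

lemma ennreal_mult_assoc:
  "0 \<le> a \<Longrightarrow> 0 \<le> b \<Longrightarrow> ennreal a * (ennreal b * x) = ennreal (a * b) * x"
  by (simp add: ennreal_mult mult.assoc)

text \<open>The absolute value in the constant covers both monotonicity directions of the power;
  \<open>s\<close> will be \<open>p - 2\<close>, which is negative for \<open>p < 2\<close>.\<close>

lemma powr_comparable:
  fixes d x s :: real
  assumes "0 < d" "d / 2 \<le> x" "x \<le> 2 * d"
  shows "d powr s \<le> 2 powr \<bar>s\<bar> * x powr s"
proof (cases "0 \<le> s")
  case True
  then have "d powr s \<le> (2 * x) powr s" using assms by (intro powr_mono2) auto
  then show ?thesis using True assms by (simp add: powr_mult)
next
  case False
  then have "(2 * d) powr s \<le> x powr s" using assms by (intro powr_mono2') auto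
  moreover have "d powr s = 2 powr \<bar>s\<bar> * (2 * d) powr s"
    using False assms by (simp add: powr_mult powr_minus)
  ultimately show ?thesis by (simp add: mult_left_mono)
qed

lemma norm_ball_half:
  fixes z :: complex
  assumes "w \<in> ball z ((1 - norm z) / 2)"
  shows "(1 - norm z) / 2 < 1 - norm w" "1 - norm w < 3 / 2 * (1 - norm z)"
  using assms norm_triangle_ineq3[of w z] by (auto simp: dist_norm norm_minus_commute abs_le_iff)

text \<open>The three factors come from the halved modulus in the submean inequality, from freezing
  the weight at the centre of the ball, and from the area pi (d/2)^2 of that ball.\<close>

definition besov_const :: "real \<Rightarrow> real" where
  "besov_const p = 2 powr p * 2 powr \<bar>p - 2\<bar> * 4 / pi"

lemma besov_const_pos: "0 < besov_const p"
  by (simp add: besov_const_def)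

text \<open>The weight is essentially constant on the ball of half the distance to the boundary, so
  the submean inequality for \<open>deriv f\<close> carries over to the weighted integral. The
  integral is kept local, because the growth estimate adds up such bounds over different
  annuli.\<close>

lemma besov_pointwise:
  assumes f: "f holomorphic_on \<D>" and p: "1 \<le> p" and z: "z \<in> \<D>"
  shows "ennreal (((1 - norm z) * norm (deriv f z)) powr p)
    \<le> ennreal (besov_const p) * (\<integral>\<^sup>+w. ennreal (besov_density p f w) * indicator (ball z ((1 - norm z) / 2)) w \<partial>lborel)"
    (is "_ \<le> _ * ?I")
proof -
  define d where "d = 1 - norm z"
  have d: "0 < d" using z by (simp add: d_def)
  let ?B = "ball z (d / 2)"
  have sub: "?B \<subseteq> \<D>" using norm_ball_half(1)[of _ z] d by (force simp: d_def)
  have "deriv f holomorphic_on ?B"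
    using f sub by (meson holomorphic_deriv holomorphic_on_subset open_ball)
  from holomorphic_powr_area_submean[OF this _ p]
  have "ennreal ((norm (deriv f z) / 2) powr p * (pi * (d / 2)\<^sup>2))
      \<le> (\<integral>\<^sup>+w. ennreal (indicator ?B w * norm (deriv f w) powr p) \<partial>lborel)"
    using d by simp
  also have "\<dots> \<le> (\<integral>\<^sup>+w. ennreal (2 powr \<bar>p - 2\<bar> * d powr (2 - p)) * (ennreal (besov_density p f w) * indicator ?B w) \<partial>lborel)"
  proof (intro nn_integral_mono)
    fix w
    show "ennreal (indicator ?B w * norm (deriv f w) powr p) \<le>
      ennreal (2 powr \<bar>p - 2\<bar> * d powr (2 - p)) * (ennreal (besov_density p f w) * indicator ?B w)"
    proof (cases "w \<in> ?B")
      case True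
      then have "w \<in> \<D>" using sub by blast
      have "1 = d powr (2 - p) * d powr (p - 2)"
        using d by (simp flip: powr_add)
      also have "\<dots> \<le> d powr (2 - p) * (2 powr \<bar>p - 2\<bar> * (1 - norm w) powr (p - 2))"
        using norm_ball_half[of w z] True d
        by (intro mult_left_mono powr_comparable) (auto simp: d_def)
      finally have "1 * norm (deriv f w) powr p
         \<le> (d powr (2 - p) * (2 powr \<bar>p - 2\<bar> * (1 - norm w) powr (p - 2))) * norm (deriv f w) powr p"
        by (intro mult_right_mono) auto
      also have "\<dots> = (2 powr \<bar>p - 2\<bar> * d powr (2 - p)) * besov_density p f w"
        using \<open>w \<in> \<D>\<close> by (simp add: besov_density_def mult_ac)
      finally show ?thesis
        using True by (auto simp: ennreal_leI besov_density_nonneg simp flip: ennreal_mult)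
    qed simp
  qed
  also have "\<dots> = ennreal (2 powr \<bar>p - 2\<bar> * d powr (2 - p)) * ?I"
  proof -
    have [measurable]: "besov_density p f \<in> borel_measurable borel" "ball z r \<in> sets borel" for r
      using borel_measurable_besov_density[OF f] by simp_all
    show ?thesis unfolding d_def by (rule nn_integral_cmult) measurable
  qed
  \<comment> \<open>The multiplier is chosen so that the left side becomes (d |f'(z)|)^p: d^(p-2)
    and the d^2 of the area give d^p, and the remaining constants cancel.\<close>
  finally have "ennreal (d powr (p - 2) * 2 powr p * 4 / pi) *
        ennreal ((norm (deriv f z) / 2) powr p * (pi * (d / 2)\<^sup>2))
     \<le> ennreal (d powr (p - 2) * 2 powr p * 4 / pi) * (ennreal (2 powr \<bar>p - 2\<bar> * d powr (2 - p)) * ?I)"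
    by (rule mult_left_mono) simp
  also have "\<dots> = ennreal ((d powr (p - 2) * 2 powr p * 4 / pi) * (2 powr \<bar>p - 2\<bar> * d powr (2 - p))) * ?I"
    by (rule ennreal_mult_assoc) auto
  also have "(d powr (p - 2) * 2 powr p * 4 / pi) * (2 powr \<bar>p - 2\<bar> * d powr (2 - p)) = besov_const p"
  proof -
    have "d powr (p - 2) * d powr (2 - p) = 1" using d by (simp flip: powr_add)
    then show ?thesis by (simp add: besov_const_def mult_ac)
  qed
  also have "ennreal (d powr (p - 2) * 2 powr p * 4 / pi) *
        ennreal ((norm (deriv f z) / 2) powr p * (pi * (d / 2)\<^sup>2)) = ennreal ((d * norm (deriv f z)) powr p)"
  proof -
    have "d powr p = d powr (p - 2) * d\<^sup>2"
      using d powr_add[of d "p - 2" 2] by simp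
    then show ?thesis using d
      by (subst ennreal_mult[symmetric]) (auto simp: powr_divide powr_mult power2_eq_square)
  qed
  finally show ?thesis by (simp add: d_def)
qed

lemma one_minus_norm_sq_pos: "z \<in> \<D> \<Longrightarrow> 0 < 1 - (norm z)\<^sup>2" for z :: complex
  by (simp add: abs_square_less_1)

lemma one_minus_norm_sq_bounds:
  fixes z :: complex
  assumes "norm z < 1"
  shows "1 - norm z \<le> 1 - (norm z)\<^sup>2" "1 - (norm z)\<^sup>2 \<le> 2 * (1 - norm z)"
proof -
  have eq: "1 - (norm z)\<^sup>2 = (1 + norm z) * (1 - norm z)" by (simp add: power2_eq_square algebra_simps)
  show "1 - norm z \<le> 1 - (norm z)\<^sup>2"
    unfolding eq using assms mult_right_mono[of 1 "1 + norm z" "1 - norm z"] by simp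
  show "1 - (norm z)\<^sup>2 \<le> 2 * (1 - norm z)"
    unfolding eq using assms by (intro mult_right_mono) auto
qed

lemma Besov_imp_bounded:
  assumes f: "f \<in> Besov p" and p: "1 \<le> p"
  obtains K where "\<And>z. z \<in> \<D> \<Longrightarrow> (1 - (norm z)\<^sup>2) * norm (deriv f z) \<le> K"
proof
  fix z assume z: "z \<in> \<D>"
  have hol: "f holomorphic_on \<D>" and fin: "besov_int p f < \<infinity>" using f by (auto simp: Besov_iff)
  define x where "x = (1 - norm z) * norm (deriv f z)"
  have x: "0 \<le> x" using z by (simp add: x_def)
  have "ennreal (x powr p) \<le> ennreal (besov_const p) * besov_int p f"
    unfolding besov_int_def x_def
    by (rule order_trans[OF besov_pointwise[OF hol p z]])
       (auto intro!: mult_left_mono nn_integral_mono simp: indicator_def)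
  also have "\<dots> = ennreal (besov_const p * enn2real (besov_int p f))"
    using fin besov_const_pos[of p] by (simp add: ennreal_mult less_top[symmetric])
  finally have "x powr p \<le> besov_const p * enn2real (besov_int p f)"
    using besov_const_pos[of p] by (subst (asm) ennreal_le_iff) auto
  then have "(x powr p) powr (1 / p) \<le> (besov_const p * enn2real (besov_int p f)) powr (1 / p)"
    using p by (intro powr_mono2) auto
  then have "x \<le> (besov_const p * enn2real (besov_int p f)) powr (1 / p)"
    using p x by (simp add: powr_powr)
  moreover have "(1 - (norm z)\<^sup>2) * norm (deriv f z) \<le> 2 * x"
    using one_minus_norm_sq_bounds(2)[of z] z by (simp add: x_def mult_right_mono flip: mult.assoc)
  ultimately show "(1 - (norm z)\<^sup>2) * norm (deriv f z) \<le> 2 * (besov_const p * enn2real (besov_int p f)) powr (1 / p)"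
    by linarith
qed

section \<open>Growth of Besov functions\<close>

lemma ennreal_le_suminf: "f k \<le> suminf f" for f :: "nat \<Rightarrow> ennreal"
  using sum_le_suminf[of f "{k}"] by simp

text \<open>The dyadic annulus (1/2)^(k+1) \<le> 1-|z| \<le> (1/2)^k is widened on both sides so as
  to contain the balls of \<open>besov_pointwise\<close> about all of its points.\<close>

definition dyadic_annulus :: "nat \<Rightarrow> complex set" where
  "dyadic_annulus k = {w. (1/2) ^ k / 4 < 1 - norm w \<and> 1 - norm w < 2 * (1/2) ^ k}"

text \<open>The two bounds on 1-|w| differ by the factor 8 = 2^3, so the indices of the annuli
  containing a given point lie within three consecutive integers.\<close>

lemma sum_indicator_dyadic_annulus:
  "(\<Sum>k<n. indicator (dyadic_annulus k) w :: ennreal) \<le> 3"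
proof -
  let ?K = "{k \<in> {..<n}. w \<in> dyadic_annulus k}"
  have "card ?K \<le> 3"
  proof (cases "?K = {}")
    case False
    define k0 where "k0 = Min ?K"
    have k0: "k0 \<in> ?K" unfolding k0_def using False by (intro Min_in) auto
    have "?K \<subseteq> {k0..k0 + 2}"
    proof
      fix k assume k: "k \<in> ?K"
      have "\<not> k0 + 3 \<le> k"
      proof
        assume "k0 + 3 \<le> k"
        then have "(1/2::real) ^ k \<le> (1/2) ^ (k0 + 3)" by (intro power_decreasing) auto
        also have "\<dots> = (1/2) ^ k0 / 8" by (simp add: power_add power3_eq_cube)
        finally show False using k k0 by (auto simp: dyadic_annulus_def)
      qed
      moreover have "k0 \<le> k" unfolding k0_def using k by (intro Min_le) auto
      ultimately show "k \<in> {k0..k0 + 2}" by auto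
    qed
    from card_mono[OF _ this] show ?thesis by simp
  next
    case True
    show ?thesis unfolding True by simp
  qed
  have "(\<Sum>k<n. indicator (dyadic_annulus k) w :: ennreal) = of_nat (card ?K)"
    by (simp add: indicator_def sum.If_cases Int_def)
  moreover have "of_nat (card ?K) \<le> (of_nat 3 :: ennreal)"
    using \<open>card ?K \<le> 3\<close> by (rule of_nat_mono)
  ultimately show ?thesis by simp
qed

lemma sum_besov_dyadic:
  assumes f: "f holomorphic_on \<D>"
  shows "(\<Sum>k<n. \<integral>\<^sup>+w. ennreal (besov_density p f w) * indicator (dyadic_annulus k) w \<partial>lborel) \<le> 3 * besov_int p f"
proof -
  have [measurable]: "besov_density p f \<in> borel_measurable borel"
    by (rule borel_measurable_besov_density[OF f])
  have "dyadic_annulus k = {w \<in> space borel. (1/2) ^ k / 4 < 1 - norm w \<and> 1 - norm w < 2 * (1/2) ^ k}" for k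
    by (simp add: dyadic_annulus_def)
  then have [measurable]: "dyadic_annulus k \<in> sets borel" for k by simp
  have "(\<Sum>k<n. \<integral>\<^sup>+w. ennreal (besov_density p f w) * indicator (dyadic_annulus k) w \<partial>lborel)
     = (\<integral>\<^sup>+w. (\<Sum>k<n. ennreal (besov_density p f w) * indicator (dyadic_annulus k) w) \<partial>lborel)"
    by (rule nn_integral_sum[symmetric]) measurable
  also have "\<dots> \<le> (\<integral>\<^sup>+w. 3 * ennreal (besov_density p f w) \<partial>lborel)"
  proof (intro nn_integral_mono)
    fix w
    have "ennreal (besov_density p f w) * (\<Sum>k<n. indicator (dyadic_annulus k) w) \<le> ennreal (besov_density p f w) * 3"
      by (intro mult_left_mono sum_indicator_dyadic_annulus) simp
    then show "(\<Sum>k<n. ennreal (besov_density p f w) * indicator (dyadic_annulus k) w) \<le> 3 * ennreal (besov_density p f w)"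
      by (simp add: sum_distrib_left mult.commute)
  qed
  also have "\<dots> = 3 * besov_int p f"
    unfolding besov_int_def by (rule nn_integral_cmult) measurable
  finally show ?thesis .
qed

text \<open>Taking a \<open>p\<close>-th root of the local integral \<open>m\<close> would give
  terms that need Hoelder's inequality when summed. \<open>powr_splitting\<close> gives a bound
  linear in \<open>m\<close> instead, with a parameter \<open>l\<close> that is fixed only after the
  summation over \<open>k\<close>. The factor \<open>2 ^ Suc k\<close> bounds 1/(1-s).\<close>

lemma besov_radial_bound:
  assumes f: "f holomorphic_on \<D>" and p: "1 \<le> p" and e: "norm e = 1"
    and s: "1 - (1/2) ^ k \<le> s" "s \<le> 1 - (1/2) ^ Suc k"
    and m: "(\<integral>\<^sup>+w. ennreal (besov_density p f w) * indicator (dyadic_annulus k) w \<partial>lborel) \<le> ennreal m" "0 \<le> m"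
    and l: "0 < l"
  shows "norm (deriv f (of_real s * e)) \<le> 2 ^ Suc k * (l powr (1 - p) * (besov_const p * m) + l)"
proof -
  define z where "z = of_real s * e"
  have "0 \<le> 1 - (1/2::real) ^ k" by (simp add: power_le_one)
  then have "0 \<le> s" using s by linarith
  then have nz: "norm z = s" using e by (simp add: z_def norm_mult)
  have s': "(1/2) ^ k / 2 \<le> 1 - s" "1 - s \<le> (1/2) ^ k" using s by auto
  have pos: "0 < (1/2::real) ^ k" by simp
  have "s < 1" using s' pos by linarith
  then have z: "z \<in> \<D>" using nz by simp
  define x where "x = (1 - norm z) * norm (deriv f z)"
  have x: "0 \<le> x" using z by (simp add: x_def)
  have sub: "ball z ((1 - norm z) / 2) \<subseteq> dyadic_annulus k"
  proof
    fix w assume "w \<in> ball z ((1 - norm z) / 2)"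
    note w = norm_ball_half[OF this]
    define h where "h = (1/2::real) ^ k"
    have "h / 4 < 1 - norm w" "1 - norm w < 2 * h"
      using w s' pos unfolding nz h_def[symmetric] by argo+
    then show "w \<in> dyadic_annulus k" by (simp add: dyadic_annulus_def h_def)
  qed
  have "ennreal (x powr p) \<le> ennreal (besov_const p) *
      (\<integral>\<^sup>+w. ennreal (besov_density p f w) * indicator (dyadic_annulus k) w \<partial>lborel)"
    unfolding x_def using sub
    by (intro order_trans[OF besov_pointwise[OF f p z]] mult_left_mono nn_integral_mono)
       (auto simp: indicator_def)
  also have "\<dots> \<le> ennreal (besov_const p) * ennreal m"
    by (intro mult_left_mono m) auto
  also have "\<dots> = ennreal (besov_const p * m)"
    using m(2) besov_const_pos[of p] by (simp add: ennreal_mult)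
  finally have xp: "x powr p \<le> besov_const p * m"
    using m(2) besov_const_pos[of p] by (subst (asm) ennreal_le_iff) auto
  have "x \<le> l powr (1 - p) * x powr p + l" by (rule powr_splitting[OF x l p])
  also have "\<dots> \<le> l powr (1 - p) * (besov_const p * m) + l"
    using xp by (simp add: mult_left_mono)
  finally have le: "x \<le> l powr (1 - p) * (besov_const p * m) + l" .
  have "1 \<le> 2 ^ Suc k * (1 - s)"
    using mult_left_mono[OF s'(1), of "2 ^ Suc k"] by (simp add: power_one_over)
  then have "1 * norm (deriv f z) \<le> (2 ^ Suc k * (1 - s)) * norm (deriv f z)"
    by (intro mult_right_mono) auto
  also have "\<dots> = 2 ^ Suc k * x" by (simp add: x_def nz)
  also have "\<dots> \<le> 2 ^ Suc k * (l powr (1 - p) * (besov_const p * m) + l)"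
    using le by (intro mult_left_mono) auto
  finally show ?thesis by (simp add: z_def)
qed

text \<open>Each step crosses at most one dyadic interval of the radius. Its length, at most
  (1/2)^(n+1), cancels the factor \<open>2 ^ Suc n\<close> in the derivative bound, so every
  interval contributes one summand without a power of 2.\<close>

lemma besov_radial_growth:
  assumes f: "f holomorphic_on \<D>" and p: "1 \<le> p" and e: "norm e = 1" and l: "0 < l"
    and m: "\<And>k. (\<integral>\<^sup>+w. ennreal (besov_density p f w) * indicator (dyadic_annulus k) w \<partial>lborel) \<le> ennreal (m k)"
           "\<And>k. 0 \<le> m k"
    and s: "0 \<le> s" "s \<le> 1 - (1/2) ^ n"
  shows "norm (f (of_real s * e) - f 0) \<le> (\<Sum>k<n. l powr (1 - p) * (besov_const p * m k) + l)"
  using s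
proof (induction n arbitrary: s)
  case 0
  then show ?case by simp
next
  case (Suc n)
  let ?c = "l powr (1 - p) * (besov_const p * m n) + l"
  have c: "0 \<le> ?c" using l m(2)[of n] besov_const_pos[of p] by simp
  show ?case
  proof (cases "s \<le> 1 - (1/2) ^ n")
    case True
    then show ?thesis using Suc.IH[OF Suc.prems(1) True] c by simp
  next
    case False
    define s0 :: real where "s0 = 1 - (1/2) ^ n"
    have s0: "0 \<le> s0" "s0 \<le> s" using False by (auto simp: s0_def power_le_one)
    let ?S = "closed_segment (of_real s0 * e) (of_real s * e)"
    have S: "\<exists>t. s0 \<le> t \<and> t \<le> s \<and> x = of_real t * e" if "x \<in> ?S" for x
    proof -
      from that obtain u where u: "0 \<le> u" "u \<le> 1" "x = (1 - u) *\<^sub>R (of_real s0 * e) + u *\<^sub>R (of_real s * e)"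
        unfolding in_segment by blast
      have "s0 + u * (s - s0) \<le> s0 + 1 * (s - s0)"
        using u s0 by (intro add_left_mono mult_right_mono) auto
      moreover have "0 \<le> u * (s - s0)" using u s0 by simp
      moreover have "x = of_real (s0 + u * (s - s0)) * e"
        using u by (simp add: scaleR_conv_of_real algebra_simps)
      ultimately have "s0 \<le> s0 + u * (s - s0)" "s0 + u * (s - s0) \<le> s" "x = of_real (s0 + u * (s - s0)) * e"
        by simp_all
      then show ?thesis by blast
    qed
    have "norm (f (of_real s * e) - f (of_real s0 * e))
        \<le> (2 ^ Suc n * ?c) * norm (of_real s * e - of_real s0 * e)"
    proof (rule field_differentiable_bound[where S = ?S and f' = "deriv f"])
      fix x assume "x \<in> ?S"
      from S[OF this] obtain t where t: "s0 \<le> t" "t \<le> s" "x = of_real t * e" by blast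
      have "0 < (1/2::real) ^ Suc n" by simp
      then have "t < 1" using t(2) Suc.prems(2) by linarith
      then have "norm x < 1" using t s0 e by (simp add: norm_mult)
      then show "(f has_field_derivative deriv f x) (at x within ?S)"
        using f by (intro holomorphic_derivI[OF _ open_ball]) auto
      show "norm (deriv f x) \<le> 2 ^ Suc n * ?c"
        using t s0 Suc.prems(2) unfolding t(3)
        by (intro besov_radial_bound f p e m l) (auto simp: s0_def)
    qed auto
    also have "norm (of_real s * e - of_real s0 * e) = s - s0"
      using e s0 by (simp add: norm_mult flip: left_diff_distrib of_real_diff)
    also have "(2 ^ Suc n * ?c) * (s - s0) \<le> (2 ^ Suc n * ?c) * (1/2) ^ Suc n"
      using Suc.prems(2) c by (intro mult_left_mono) (auto simp: s0_def)
    also have "\<dots> = ?c" by (simp add: power_one_over)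
    finally have "norm (f (of_real s * e) - f (of_real s0 * e)) \<le> ?c" .
    moreover have "norm (f (of_real s0 * e) - f 0) \<le> (\<Sum>k<n. l powr (1 - p) * (besov_const p * m k) + l)"
      by (rule Suc.IH) (use s0 in \<open>auto simp: s0_def\<close>)
    ultimately show ?thesis
      using norm_triangle_ineq[of "f (of_real s * e) - f (of_real s0 * e)" "f (of_real s0 * e) - f 0"]
      by simp
  qed
qed

text \<open>The numerator 2 keeps the logarithmic weight away from zero, also at the origin, and
  compensates for 1-|z|^2 being as large as 2(1-|z|).\<close>

lemma log_weight_ge: 
  assumes "z \<in> \<D>"
  shows "ln 2 \<le> ln (2 / (1 - (norm z)\<^sup>2))"
    "ln (1 / (1 - norm z)) \<le> ln (2 / (1 - (norm z)\<^sup>2))"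
proof -
  have z: "norm z < 1" using assms by simp
  have sq: "0 < 1 - (norm z)\<^sup>2" by (rule one_minus_norm_sq_pos[OF assms])
  show "ln 2 \<le> ln (2 / (1 - (norm z)\<^sup>2))" using sq by (auto simp: field_simps)
  from one_minus_norm_sq_bounds(2)[OF z] show "ln (1 / (1 - norm z)) \<le> ln (2 / (1 - (norm z)\<^sup>2))"
    using sq z by (auto simp: field_simps)
qed

lemma exists_dyadic_level:
  fixes d :: real
  assumes "0 < d" "d \<le> 1"
  obtains n where "(1/2) ^ n \<le> d" "real n \<le> ln (1 / d) / ln 2 + 1"
proof
  define n where "n = nat \<lceil>log 2 (1 / d)\<rceil>"
  have "0 \<le> log 2 (1 / d)" using assms by simp
  then have n: "log 2 (1 / d) \<le> real n" "real n \<le> log 2 (1 / d) + 1"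
    unfolding n_def by linarith+
  from n(1) have "1 / d \<le> 2 powr real n"
    using assms by (subst le_powr_iff) auto
  then show "(1/2) ^ n \<le> d"
    using assms by (simp add: powr_realpow power_one_over field_simps)
  show "real n \<le> ln (1 / d) / ln 2 + 1" using n(2) by (simp add: log_def)
qed

lemma Besov_growth:
  assumes f: "f \<in> Besov p" and p: "1 \<le> p"
  obtains C where "0 \<le> C" "\<And>z. z \<in> \<D> \<Longrightarrow> norm (f z) \<le> C * ln (2 / (1 - (norm z)\<^sup>2)) powr (1 - 1 / p)"
proof -
  have hol: "f holomorphic_on \<D>" and fin: "besov_int p f < \<infinity>" using f by (auto simp: Besov_iff)
  define S where "S = enn2real (besov_int p f)"
  have S: "0 \<le> S" "besov_int p f = ennreal S" using fin by (auto simp: S_def less_top[symmetric])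
  let ?M = "\<lambda>k. \<integral>\<^sup>+w. ennreal (besov_density p f w) * indicator (dyadic_annulus k) w \<partial>lborel"
  define m where "m k = enn2real (?M k)" for k
  have Msum: "(\<Sum>k<n. ?M k) \<le> ennreal (3 * S)" for n
    using sum_besov_dyadic[OF hol, of p n] S by (simp add: ennreal_mult)
  have Mk: "?M k = ennreal (m k)" for k
  proof -
    have "?M k \<le> (\<Sum>k<Suc k. ?M k)" by (rule member_le_sum) auto
    also have "\<dots> \<le> ennreal (3 * S)" by (rule Msum)
    also have "\<dots> < \<infinity>" by simp
    finally have "?M k < \<infinity>" .
    then show ?thesis by (simp add: m_def less_top[symmetric])
  qed
  have m0: "0 \<le> m k" for k by (simp add: m_def)
  have msum: "(\<Sum>k<n. m k) \<le> 3 * S" for n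
  proof -
    have "ennreal (\<Sum>k<n. m k) = (\<Sum>k<n. ?M k)" using m0 by (subst sum_ennreal[symmetric]) (auto simp: Mk)
    also have "\<dots> \<le> ennreal (3 * S)" by (rule Msum)
    finally show ?thesis using S by (subst (asm) ennreal_le_iff) auto
  qed
  define q where "q = 1 - 1 / p"
  have q: "0 \<le> q" using p by (simp add: q_def)
  define c where "c = norm (f 0) + besov_const p * (3 * S) + 1"
  have c: "0 \<le> c" using S besov_const_pos[of p] by (simp add: c_def)
  show ?thesis
  proof
    show "0 \<le> c * (3 / ln 2) powr q" using c by simp
    fix z assume z: "z \<in> \<D>"
    define L where "L = ln (2 / (1 - (norm z)\<^sup>2))"
    have L: "ln 2 \<le> L" "ln (1 / (1 - norm z)) \<le> L" using log_weight_ge[OF z] by (auto simp: L_def)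
    obtain n where n: "(1/2) ^ n \<le> 1 - norm z" "real n \<le> ln (1 / (1 - norm z)) / ln 2 + 1"
      using exists_dyadic_level[of "1 - norm z"] z by auto
    \<comment> \<open>The added 1 gives \<open>1 \<le> N\<close>, so that a power of
      \<open>N\<close> also absorbs the constant term |f(0)|.\<close>
    define N where "N = real n + 1"
    have "ln (1 / (1 - norm z)) / ln 2 \<le> L / ln 2" "1 \<le> L / ln 2"
      using L by (auto simp: divide_right_mono)
    then have "N \<le> 3 * (L / ln 2)" using n(2) unfolding N_def by linarith
    then have N: "1 \<le> N" "N \<le> 3 / ln 2 * L" by (simp_all add: N_def)
    \<comment> \<open>This choice balances the two parts of the sum: \<open>l powr (1 - p)\<close>
      times the bounded total of the \<open>m k\<close>, and \<open>N * l\<close>, are both of order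
      N^(1-1/p). The exponent 1/p' arises here.\<close>
    define l where "l = N powr (- 1 / p)"
    have l: "0 < l" using N by (simp add: l_def)
    have "- 1 / p * (1 - p) = q" using p by (simp add: q_def field_simps)
    then have lp: "l powr (1 - p) = N powr q" by (simp add: l_def powr_powr)
    have nl: "real n * l \<le> N powr q"
    proof -
      have "real n * l \<le> N * l" using l by (intro mult_right_mono) (auto simp: N_def)
      also have "\<dots> = N powr q" using N by (simp add: l_def q_def powr_diff powr_minus field_simps)
      finally show ?thesis .
    qed
    obtain e where e: "norm e = 1" "z = of_real (norm z) * e"
    proof (cases "z = 0")
      case True
      then show ?thesis by (intro that[of 1]) auto
    next
      case False
      then show ?thesis by (intro that[of "z / of_real (norm z)"]) (auto simp: norm_divide)
    qed
    have "norm (f z - f 0) \<le> (\<Sum>k<n. l powr (1 - p) * (besov_const p * m k) + l)"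
      by (subst e(2), rule besov_radial_growth[OF hol p e(1) l])
         (use n in \<open>auto simp: Mk m0\<close>)
    also have "\<dots> = N powr q * (besov_const p * (\<Sum>k<n. m k)) + real n * l"
      by (simp add: sum.distrib lp sum_distrib_left mult.assoc)
    also have "\<dots> \<le> N powr q * (besov_const p * (3 * S)) + N powr q"
      using besov_const_pos[of p] msum[of n] nl by (intro add_mono mult_left_mono) auto
    finally have "norm (f z) \<le> norm (f 0) + N powr q * (besov_const p * (3 * S)) + N powr q"
      using norm_triangle_ineq[of "f z - f 0" "f 0"] by simp
    moreover have "norm (f 0) * 1 \<le> norm (f 0) * N powr q"
      using N q by (intro mult_left_mono ge_one_powr_ge_zero) auto
    ultimately have "norm (f z) \<le> c * N powr q" by (simp add: c_def algebra_simps)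
    also have "\<dots> \<le> c * (3 / ln 2 * L) powr q"
      using N q c by (intro mult_left_mono powr_mono2) auto
    also have "\<dots> = c * (3 / ln 2) powr q * L powr q"
      using L by (subst powr_mult) (auto intro: order_trans[of 0 "ln 2"])
    finally show "norm (f z) \<le> c * (3 / ln 2) powr q * ln (2 / (1 - (norm z)\<^sup>2)) powr (1 - 1 / p)"
      by (simp add: L_def q_def)
  qed
qed

section \<open>A gliding hump argument\<close>

text \<open>
  Coefficients \<open>c k\<close> of modulus \<open>3^-k\<close> are chosen recursively, with a sign that prevents cancellation
  between the \<open>k\<close>-th term and the previous ones in row \<open>n k\<close>. As \<open>A (n k) (m k)\<close> is nearly maximal
  in its row, the tail of the series is at most two thirds of the \<open>k\<close>-th term.
\<close>

lemma gliding_hump: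
  fixes A :: "'a \<Rightarrow> 'b \<Rightarrow> complex"
  assumes fin: "\<And>n. n \<in> X \<Longrightarrow> \<exists>K. \<forall>m\<in>Y. norm (A n m) \<le> K"
    and ser: "\<And>c m. (\<And>k. m k \<in> Y) \<Longrightarrow> (\<And>k::nat. norm (c k) = (1/3) ^ k) \<Longrightarrow>
       \<exists>B. \<forall>n\<in>X. norm (\<Sum>k. c k * A n (m k)) \<le> B"
  shows "\<exists>B. \<forall>n\<in>X. \<forall>m\<in>Y. norm (A n m) \<le> B"
proof (rule ccontr)
  assume unb: "\<not> ?thesis"
  have "\<exists>n m. n \<in> X \<and> m \<in> Y \<and> real k * 3 ^ k \<le> norm (A n m) \<and> 0 < norm (A n m) \<and>
      (\<forall>m'\<in>Y. norm (A n m') \<le> 4 / 3 * norm (A n m))" for k :: nat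
  proof -
    \<comment> \<open>The factor 4/3 pays for an entry that reaches only 3/4 of the supremum of its
      row; the added 1 makes that entry nonzero.\<close>
    obtain n m0 where n: "n \<in> X" "m0 \<in> Y" "4 / 3 * (real k * 3 ^ k + 1) < norm (A n m0)"
      using unb by (meson not_le)
    let ?V = "(\<lambda>m. norm (A n m)) ` Y"
    have bdd: "bdd_above ?V" using fin[OF n(1)] by (auto simp: bdd_above_def)
    have le: "norm (A n m) \<le> Sup ?V" if "m \<in> Y" for m
      using that bdd by (intro cSup_upper) auto
    define v where "v = real k * 3 ^ k"
    define W where "W = Sup ?V"
    have v: "0 \<le> v" by (simp add: v_def)
    have big: "4 / 3 * (v + 1) < W"
      using le[OF n(2)] n(3) unfolding v_def W_def by (rule less_le_trans[rotated])
    have W: "0 < W" using big v by argo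
    then have "3 / 4 * W < W" by simp
    moreover have "?V \<noteq> {}" using n(2) by blast
    ultimately have "\<exists>x\<in>?V. 3 / 4 * W < x"
      unfolding W_def using less_cSup_iff[OF _ bdd] by blast
    then obtain m where m: "m \<in> Y" "3 / 4 * W < norm (A n m)" by blast
    show ?thesis
    proof (intro exI conjI ballI)
      show "real k * 3 ^ k \<le> norm (A n m)" "0 < norm (A n m)"
        using m(2) big v W unfolding v_def[symmetric] by argo+
      fix m' assume "m' \<in> Y"
      from le[OF this] show "norm (A n m') \<le> 4 / 3 * norm (A n m)"
        using m(2) unfolding W_def[symmetric] by argo
    qed (use n m in auto)
  qed
  then obtain n m where nm: "\<And>k. n k \<in> X" "\<And>k. m k \<in> Y" "\<And>k::nat. real k * 3 ^ k \<le> norm (A (n k) (m k))"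
      "\<And>k. 0 < norm (A (n k) (m k))" "\<And>k m'. m' \<in> Y \<Longrightarrow> norm (A (n k) m') \<le> 4 / 3 * norm (A (n k) (m k))"
    by metis
  let ?a = "\<lambda>k j. A (n k) (m j)"
  have "\<exists>c. \<forall>k. norm (c k) = (1/3) ^ k \<and>
      (1/3) ^ k * norm (?a k k) \<le> norm ((\<Sum>j<k. c j * ?a k j) + c k * ?a k k)"
  \<comment> \<open>Recursive choice along the naturals. The first goal says that the condition on
    the \<open>x\<close>-th coefficient depends on the earlier coefficients only.\<close>
  proof (rule dependent_wf_choice[of less_than])
    fix f g :: "nat \<Rightarrow> complex" and x r
    assume "\<And>z. (z, x) \<in> less_than \<Longrightarrow> f z = g z"
    then have "(\<Sum>j<x. f j * ?a x j) = (\<Sum>j<x. g j * ?a x j)" by (intro sum.cong) auto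
    then show "(norm r = (1/3) ^ x \<and> (1/3) ^ x * norm (?a x x) \<le> norm ((\<Sum>j<x. f j * ?a x j) + r * ?a x x)) =
      (norm r = (1/3) ^ x \<and> (1/3) ^ x * norm (?a x x) \<le> norm ((\<Sum>j<x. g j * ?a x j) + r * ?a x x))"
      by simp
  next
    fix x :: nat and f :: "nat \<Rightarrow> complex"
    let ?s = "\<Sum>j<x. f j * ?a x j" and ?t = "(1/3) ^ x * ?a x x"
    \<comment> \<open>At least one of the two signs leaves a modulus not below that of the new
      term.\<close>
    have "2 * norm ?t \<le> norm (?s + ?t) + norm (?s - ?t)"
      using norm_triangle_ineq4[of "?s + ?t" "?s - ?t"] by (simp flip: mult_2 add: norm_mult norm_power)
    then consider "norm ?t \<le> norm (?s + ?t)" | "norm ?t \<le> norm (?s - ?t)" by linarith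
    then show "\<exists>r. norm r = (1/3) ^ x \<and> (1/3) ^ x * norm (?a x x) \<le> norm (?s + r * ?a x x)"
    proof cases
      case 1
      then show ?thesis by (intro exI[of _ "(1/3) ^ x"]) (auto simp: norm_mult norm_power)
    next
      case 2
      then show ?thesis by (intro exI[of _ "- ((1/3) ^ x)"]) (auto simp: norm_mult norm_power)
    qed
  qed auto
  then obtain c where c: "\<And>k. norm (c k) = (1/3) ^ k"
     "\<And>k. (1/3) ^ k * norm (?a k k) \<le> norm ((\<Sum>j<k. c j * ?a k j) + c k * ?a k k)" by blast
  obtain B where B: "\<And>x. x \<in> X \<Longrightarrow> norm (\<Sum>k. c k * A x (m k)) \<le> B"
    using ser[of m c] nm(2) c(1) by blast
  \<comment> \<open>The head of the series exceeds its tail by at least one third of (1/3)^k N, and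
    (1/3)^k N is at least \<open>k\<close>; so \<open>k > 3 * B\<close> will contradict the bound
    \<open>B\<close>.\<close>
  obtain k :: nat where k: "3 * B < real k" using reals_Archimedean2 by blast
  define N where "N = norm (?a k k)"
  have term_le: "norm (c j * ?a k j) \<le> 4 / 3 * N * (1/3) ^ j" for j
    using nm(5)[OF nm(2), of k j] c(1)[of j] by (simp add: norm_mult N_def mult.commute mult_right_mono)
  have geo: "summable (\<lambda>j. 4 / 3 * N * (1/3::real) ^ j)" by (intro summable_mult summable_geometric) simp
  have summ: "summable (\<lambda>j. c j * ?a k j)"
    by (rule summable_comparison_test[OF _ geo]) (use term_le in auto)
  \<comment> \<open>The tail starts at index k+1, so 4/3 becomes 4/9; the geometric sum 3/2 turns
    this into the 2/3 below.\<close>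
  have tail_le: "norm (c (j + Suc k) * ?a k (j + Suc k)) \<le> (4 / 9 * N * (1/3) ^ k) * (1/3) ^ j" for j
    using term_le[of "j + Suc k"] by (simp add: power_add mult_ac)
  have "norm (\<Sum>j. c (j + Suc k) * ?a k (j + Suc k)) \<le> (\<Sum>j. (4 / 9 * N * (1/3) ^ k) * (1/3) ^ j)"
    by (rule norm_suminf_le[OF tail_le]) (intro summable_mult summable_geometric, simp)
  also have "\<dots> = 2 / 3 * N * (1/3) ^ k"
    by (subst suminf_mult) (simp_all add: suminf_geometric)
  finally have tail: "norm (\<Sum>j. c (j + Suc k) * ?a k (j + Suc k)) \<le> 2 / 3 * N * (1/3) ^ k" .
  define u where "u = (\<Sum>j. c (j + Suc k) * ?a k (j + Suc k))"
  define v where "v = (\<Sum>j<k. c j * ?a k j) + c k * ?a k k"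
  have split: "(\<Sum>j. c j * ?a k j) = u + v"
    using suminf_split_initial_segment[OF summ, of "Suc k"] by (simp add: u_def v_def)
  have "norm v \<le> norm (u + v) + norm u" using norm_triangle_ineq4[of "u + v" u] by simp
  moreover have "(1/3) ^ k * N \<le> norm v" using c(2)[of k] by (simp add: v_def N_def)
  moreover have "norm u \<le> 2 / 3 * ((1/3) ^ k * N)" using tail by (simp add: u_def mult_ac)
  ultimately have "(1/3) ^ k * N - 2 / 3 * ((1/3) ^ k * N) \<le> norm (\<Sum>j. c j * ?a k j)"
    unfolding split by argo
  also have "\<dots> \<le> B" using B[OF nm(1)] .
  finally have "(1/3) ^ k * N \<le> 3 * B" by argo
  moreover have "(1/3) ^ k * (real k * 3 ^ k) \<le> (1/3) ^ k * N"
    using nm(3)[of k] by (intro mult_left_mono) (auto simp: N_def)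
  then have "real k \<le> (1/3) ^ k * N" by (simp add: power_one_over)
  ultimately show False using k by linarith
qed

section \<open>Series with geometric coefficients in Besov spaces\<close>

text \<open>Otherwise (1/3)^k x_k, being (2/3)^k times (1/2)^k x_k, lies strictly below (2/3)^k T/3
  for every k, and these numbers sum to T itself. The lemma bounds a \<open>p\<close>-th power of a
  series by the \<open>p\<close>-th power of a single term, in place of Minkowski's
  inequality.\<close>

lemma geometric_dominant_term:
  fixes x :: "nat \<Rightarrow> real"
  assumes x: "\<And>k. 0 \<le> x k" and summ: "summable (\<lambda>k. (1/3) ^ k * x k)"
  shows "\<exists>k. (\<Sum>k. (1/3) ^ k * x k) \<le> 3 * ((1/2) ^ k * x k)"
proof (rule ccontr)
  let ?T = "\<Sum>k. (1/3) ^ k * x k"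
  assume "\<not> ?thesis"
  then have less: "3 * ((1/2) ^ k * x k) < ?T" for k by (auto simp: not_le)
  have eq: "(1/3) ^ k * x k = (2/3) ^ k * ((1/2) ^ k * x k)" for k
    by (simp flip: power_mult_distrib mult.assoc)
  have lt: "(1/3) ^ k * x k < (2/3) ^ k * (?T / 3)" for k
    unfolding eq[of k] using less[of k] by (intro mult_strict_left_mono) auto
  have geo: "summable (\<lambda>k. (2/3::real) ^ k * (?T / 3))"
    by (intro summable_mult2 summable_geometric) simp
  have "0 < (\<Sum>k. (2/3) ^ k * (?T / 3) - (1/3) ^ k * x k)"
    by (rule suminf_pos) (use geo summ lt in \<open>auto intro!: summable_diff\<close>)
  also have "\<dots> = (\<Sum>k. (2/3) ^ k * (?T / 3)) - ?T"
    by (rule suminf_diff[OF geo summ, symmetric])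
  also have "(\<Sum>k. (2/3) ^ k * (?T / 3)) = ?T"
    by (subst suminf_mult2[symmetric]) (simp_all add: suminf_geometric)
  finally show False by simp
qed

text \<open>Cauchy's estimate on the circle about \<open>z\<close> of radius half the distance to
  the boundary.\<close>

lemma locally_bounded_imp_deriv_bounded:
  assumes hol: "\<And>i. i \<in> I \<Longrightarrow> f i holomorphic_on \<D>"
    and loc: "\<And>r. r < 1 \<Longrightarrow> \<exists>M. \<forall>i\<in>I. \<forall>z. norm z \<le> r \<longrightarrow> norm (f i z) \<le> M"
    and z: "z \<in> \<D>"
  shows "\<exists>M. \<forall>i\<in>I. norm (deriv (f i) z) \<le> M"
proof -
  define d where "d = (1 - norm z) / 2"
  have d: "0 < d" using z by (simp add: d_def)
  have "norm z < 1" using z by simp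
  then have d1: "norm z + d < 1" unfolding d_def by argo
  then obtain M where M: "\<And>i w. i \<in> I \<Longrightarrow> norm w \<le> norm z + d \<Longrightarrow> norm (f i w) \<le> M" using loc by blast
  have le: "norm w \<le> norm z + d" if "norm (z - w) \<le> d" for w
    using norm_triangle_ineq2[of w z] that by (simp add: norm_minus_commute)
  have cb: "cball z d \<subseteq> \<D>" using le d1 by (force simp: dist_norm)
  have "norm (deriv (f i) z) \<le> M / d" if i: "i \<in> I" for i
  proof -
    have "norm ((deriv ^^ 1) (f i) z) \<le> fact 1 * M / d ^ 1"
    proof (rule Cauchy_inequality)
      show "f i holomorphic_on ball z d" "continuous_on (cball z d) (f i)"
        using hol[OF i] cb ball_subset_cball
        by (blast intro: holomorphic_on_subset holomorphic_on_imp_continuous_on)+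
      show "norm (f i w) \<le> M" if "norm (z - w) = d" for w
        using that by (intro M i le) simp
    qed (rule d)
    then show ?thesis by simp
  qed
  then show ?thesis by blast
qed

text \<open>Local boundedness and the geometric coefficients justify termwise differentiation. For
  the Besov integral, the dominant term, whose index may vary with the point, bounds the density of
  \<open>F\<close> by that of one \<open>f k\<close> times \<open>b k\<close>, hence by the sum over
  all k, and the \<open>b k\<close> are summable.\<close>

lemma Besov_series:
  assumes p: "1 \<le> p"
    and hol: "\<And>k. f k holomorphic_on \<D>"
    and K: "\<And>k. besov_int p (f k) \<le> ennreal K"
    and loc: "\<And>r. r < 1 \<Longrightarrow> \<exists>M. \<forall>k z. norm z \<le> r \<longrightarrow> norm (f k z) \<le> M"
    and c: "\<And>k::nat. norm (c k) = (1/3) ^ k"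
  obtains F where "F \<in> Besov p"
    "\<And>z. z \<in> \<D> \<Longrightarrow> (\<lambda>k. c k * f k z) sums F z"
    "\<And>z. z \<in> \<D> \<Longrightarrow> (\<lambda>k. c k * deriv (f k) z) sums deriv F z"
proof -
  have "\<exists>F F'. \<forall>z\<in>\<D>. ((\<lambda>k. c k * f k z) sums F z) \<and> ((\<lambda>k. c k * deriv (f k) z) sums F' z) \<and>
      (F has_field_derivative F' z) (at z)"
  proof (rule series_and_derivative_comparison_local[OF open_ball])
    fix k and z :: complex assume "z \<in> \<D>"
    then show "((\<lambda>z. c k * f k z) has_field_derivative c k * deriv (f k) z) (at z)"
      using hol by (intro DERIV_cmult holomorphic_derivI[OF _ open_ball])
  next
    fix z :: complex assume z: "z \<in> \<D>"
    define r where "r = (1 + norm z) / 2"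
    obtain M where M: "\<And>k w. norm w \<le> r \<Longrightarrow> norm (f k w) \<le> M"
      using loc[of r] z by (auto simp: r_def)
    show "\<exists>d h. 0 < d \<and> summable h \<and> (\<forall>\<^sub>F k in sequentially. \<forall>y\<in>ball z d \<inter> \<D>. norm (c k * f k y) \<le> h k)"
    proof (intro exI[of _ "r - norm z"] exI[of _ "\<lambda>k. (1/3) ^ k * M"] conjI always_eventually allI ballI)
      show "0 < r - norm z" using z by (simp add: r_def)
      show "summable (\<lambda>k. (1/3) ^ k * M)" by (intro summable_mult2 summable_geometric) simp
      fix k y assume "y \<in> ball z (r - norm z) \<inter> \<D>"
      then have "norm y \<le> r" using norm_triangle_ineq2[of y z] by (simp add: dist_norm norm_minus_commute)
      then show "norm (c k * f k y) \<le> (1/3) ^ k * M"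
        using M by (simp add: norm_mult c mult_left_mono)
    qed
  qed
  then obtain F F' where F: "\<And>z. z \<in> \<D> \<Longrightarrow> (\<lambda>k. c k * f k z) sums F z"
      "\<And>z. z \<in> \<D> \<Longrightarrow> (\<lambda>k. c k * deriv (f k) z) sums F' z"
      "\<And>z. z \<in> \<D> \<Longrightarrow> (F has_field_derivative F' z) (at z)" by blast
  have holF: "F holomorphic_on \<D>" using F(3) unfolding holomorphic_on_open[OF open_ball] by blast
  have dF: "deriv F z = F' z" if "z \<in> \<D>" for z using F(3)[OF that] by (rule DERIV_imp_deriv)
  show ?thesis
  proof
    show "(\<lambda>k. c k * deriv (f k) z) sums deriv F z" if "z \<in> \<D>" for z
      using F(2) dF that by simp
    \<comment> \<open>\<open>ennreal\<close> sends negative numbers to 0; the absolute value makes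
      it multiplicative here.\<close>
    have K0: "besov_int p (f k) \<le> ennreal \<bar>K\<bar>" for k
      by (rule order_trans[OF K]) (simp add: ennreal_leI)
    \<comment> \<open>The \<open>p\<close>-th power of the factor \<open>3 * (1/2) ^ k\<close> in
      \<open>geometric_dominant_term\<close>.\<close>
    define b where "b k = 3 powr p * ((1/2) powr p) ^ k" for k :: nat
    have b: "0 \<le> b k" for k by (simp add: b_def)
    have sb: "summable b" unfolding b_def
      using p by (intro summable_mult summable_geometric) (auto simp: powr01_less_one)
    \<comment> \<open>An implication written as a disjunction; \<open>ex\<close> refutes the last
      two alternatives for the dominant index.\<close>
    have pw: "besov_density p F z \<le> b k * besov_density p (f k) z \<or> \<not> summable (\<lambda>k. (1/3) ^ k * norm (deriv (f k) z)) \<or>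
       norm (deriv F z) powr p > (3 * ((1/2) ^ k * norm (deriv (f k) z))) powr p" for k z
    proof -
      have "(3 * ((1/2) ^ k * norm (deriv (f k) z))) powr p = b k * norm (deriv (f k) z) powr p"
        by (simp add: b_def powr_mult powr_power powr_realpow[symmetric] powr_powr mult_ac)
      then show ?thesis
        by (auto simp: besov_density_def indicator_def not_less mult_left_mono mult_ac)
    qed
    have ex: "\<exists>k. besov_density p F z \<le> b k * besov_density p (f k) z" for z
    proof (cases "z \<in> \<D>")
      case True
      obtain M where M: "\<And>k. norm (deriv (f k) z) \<le> M"
        using locally_bounded_imp_deriv_bounded[of UNIV f z] hol loc True by auto
      have sm: "summable (\<lambda>k. (1/3) ^ k * norm (deriv (f k) z))"
      proof (rule summable_comparison_test)
        show "summable (\<lambda>k. (1/3) ^ k * M)" by (intro summable_mult2 summable_geometric) simp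
      qed (use M in \<open>auto intro!: mult_left_mono\<close>)
      then have "norm (deriv F z) \<le> (\<Sum>k. (1/3) ^ k * norm (deriv (f k) z))"
        using norm_suminf_le[OF _ sm, of "\<lambda>k. c k * deriv (f k) z"] F(2)[OF True] dF[OF True]
        by (simp add: norm_mult c sums_iff)
      moreover obtain k where "(\<Sum>k. (1/3) ^ k * norm (deriv (f k) z)) \<le> 3 * ((1/2) ^ k * norm (deriv (f k) z))"
        using geometric_dominant_term[OF norm_ge_zero sm] by blast
      ultimately have "norm (deriv F z) powr p \<le> (3 * ((1/2) ^ k * norm (deriv (f k) z))) powr p"
        using p by (intro powr_mono2) auto
      then show ?thesis using pw[of z k] sm by auto
    qed (auto simp: besov_density_def)
    have "besov_int p F \<le> (\<integral>\<^sup>+z. (\<Sum>k. ennreal (b k) * ennreal (besov_density p (f k) z)) \<partial>lborel)"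
      unfolding besov_int_def
    proof (intro nn_integral_mono)
      fix z
      obtain k where "besov_density p F z \<le> b k * besov_density p (f k) z" using ex by blast
      then have "ennreal (besov_density p F z) \<le> ennreal (b k) * ennreal (besov_density p (f k) z)"
        using b by (simp add: ennreal_leI besov_density_nonneg flip: ennreal_mult)
      also have "\<dots> \<le> (\<Sum>k. ennreal (b k) * ennreal (besov_density p (f k) z))"
        by (rule ennreal_le_suminf)
      finally show "ennreal (besov_density p F z) \<le> \<dots>" .
    qed
    also have "\<dots> = (\<Sum>k. ennreal (b k) * besov_int p (f k))"
    proof -
      have [measurable]: "besov_density p (f k) \<in> borel_measurable borel" for k
        by (rule borel_measurable_besov_density[OF hol])
      show ?thesis unfolding besov_int_def
        by (subst nn_integral_suminf) (simp_all add: nn_integral_cmult)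
    qed
    also have "\<dots> \<le> (\<Sum>k. ennreal (b k * \<bar>K\<bar>))"
      using K0 b by (intro suminf_le) (auto simp: ennreal_mult intro!: mult_left_mono)
    also have "\<dots> < \<infinity>"
      using summable_mult2[OF sb, of "\<bar>K\<bar>"] b
      by (metis abs_ge_zero ennreal_less_top infinity_ennreal_def mult_nonneg_nonneg suminf_ennreal2)
    finally show "F \<in> Besov p" using holF by (simp add: Besov_iff)
  qed (rule F(1))
qed

section \<open>Moebius functions in Besov spaces\<close>

lemma dyadic_level_exact:
  fixes d :: real
  assumes "0 < d" "d \<le> 1"
  obtains k where "(1/2) ^ Suc k < d" "d \<le> (1/2) ^ k"
proof -
  obtain n where "(1/2) ^ n < d" using real_arch_pow_inv[OF assms(1), of "1/2"] by auto
  then obtain k where k: "\<forall>i<k. \<not> (1/2) ^ i < d" "(1/2) ^ k < d"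
    using ex_least_nat_le[of "\<lambda>n. (1/2) ^ n < d" n] by blast
  with assms(2) obtain j where "k = Suc j" by (cases k) auto
  with k that[of j] show ?thesis by (auto simp: not_less)
qed

lemma emeasure_annulus:
  assumes "0 \<le> r" "r \<le> 1"
  shows "emeasure lborel (\<D> - ball 0 r) = ennreal (pi * (1 - r\<^sup>2))"
proof -
  have "emeasure lborel (\<D> - ball 0 r) = emeasure lborel \<D> - emeasure lborel (ball (0::complex) r)"
    using assms by (intro emeasure_Diff) (auto simp: emeasure_ball_complex)
  also have "\<dots> = ennreal (pi * (1 - r\<^sup>2))"
    using assms by (simp add: emeasure_ball_complex ennreal_minus right_diff_distrib)
  finally show ?thesis .
qed

text \<open>On the part of \<open>E k\<close> with 1-|w| close to (1/2)^k the weight is comparable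
  with (1/2)^(k(p-2)), and \<open>E k\<close> has area at most 2 pi (1/2)^k. The resulting geometric
  series has ratio (1/2)^(p-1), which is below 1 exactly because \<open>p > 1\<close>.\<close>

lemma disc_weight_integral_finite:
  assumes p: "1 < p"
  shows "(\<integral>\<^sup>+w. ennreal (indicator \<D> w * (1 - (norm w)\<^sup>2) powr (p - 2)) \<partial>lborel) < \<infinity>"
proof -
  define s where "s = p - 2"
  define E where "E k = \<D> - ball 0 (1 - (1/2) ^ k)" for k :: nat
  have [measurable]: "E k \<in> sets borel" for k by (simp add: E_def)
  \<comment> \<open>One factor \<open>2 powr \<bar>s\<bar>\<close> passes from 1-|w|^2 to 1-|w|, the
    other from 1-|w| to (1/2)^k.\<close>
  define b where "b k = 2 powr \<bar>s\<bar> * (2 powr \<bar>s\<bar> * ((1/2) ^ k) powr s)" for k :: nat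
  have b: "0 \<le> b k" for k by (simp add: b_def)
  have pw: "ennreal (indicator \<D> w * (1 - (norm w)\<^sup>2) powr s) \<le> (\<Sum>k. ennreal (b k) * indicator (E k) w)" for w
  proof (cases "w \<in> \<D>")
    case True
    then have w: "norm w < 1" by simp
    obtain k where k: "(1/2) ^ Suc k < 1 - norm w" "1 - norm w \<le> (1/2) ^ k"
      using dyadic_level_exact[of "1 - norm w"] w by auto
    have "(1 - (norm w)\<^sup>2) powr s \<le> 2 powr \<bar>s\<bar> * (1 - norm w) powr s"
      using one_minus_norm_sq_bounds[OF w] w by (intro powr_comparable) auto
    also have "(1 - norm w) powr s \<le> 2 powr \<bar>s\<bar> * ((1/2) ^ k) powr s"
      using k w by (intro powr_comparable) auto
    finally have "(1 - (norm w)\<^sup>2) powr s \<le> b k" by (simp add: b_def)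
    moreover have "w \<in> E k" using k True by (simp add: E_def)
    ultimately have "ennreal (indicator \<D> w * (1 - (norm w)\<^sup>2) powr s) \<le> ennreal (b k) * indicator (E k) w"
      using True by (simp add: ennreal_leI)
    also have "\<dots> \<le> (\<Sum>k. ennreal (b k) * indicator (E k) w)"
      by (rule ennreal_le_suminf)
    finally show ?thesis .
  qed simp
  have Ek: "emeasure lborel (E k) \<le> ennreal (2 * pi * (1/2) ^ k)" for k
  proof -
    define h where "h = (1/2::real) ^ k"
    have h: "0 \<le> 1 - h" "1 - h \<le> 1" by (auto simp: h_def power_le_one)
    have "1 - (1 - h)\<^sup>2 \<le> 2 * h" by (simp add: power2_eq_square algebra_simps)
    then have "pi * (1 - (1 - h)\<^sup>2) \<le> 2 * pi * h"
      using mult_left_mono[of "1 - (1 - h)\<^sup>2" "2 * h" pi] by simp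
    then show ?thesis
      using emeasure_annulus[OF h] by (simp add: E_def ennreal_leI flip: h_def)
  qed
  have "(\<integral>\<^sup>+w. ennreal (indicator \<D> w * (1 - (norm w)\<^sup>2) powr s) \<partial>lborel)
     \<le> (\<integral>\<^sup>+w. (\<Sum>k. ennreal (b k) * indicator (E k) w) \<partial>lborel)"
    by (intro nn_integral_mono pw)
  also have "\<dots> = (\<Sum>k. ennreal (b k) * emeasure lborel (E k))"
    by (subst nn_integral_suminf) (simp_all add: nn_integral_cmult_indicator)
  also have "\<dots> \<le> (\<Sum>k. ennreal (b k * (2 * pi * (1/2) ^ k)))"
    using Ek b by (intro suminf_le) (auto simp: ennreal_mult intro!: mult_left_mono)
  also have "\<dots> < \<infinity>"
  proof -
    have eq: "b k * (2 * pi * (1/2) ^ k) = (2 powr \<bar>s\<bar> * 2 powr \<bar>s\<bar> * 2 * pi) * ((1/2) powr (p - 1)) ^ k" for k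
    proof -
      have "((1/2) ^ k) powr s * (1/2) ^ k = ((1/2) powr (p - 1)) ^ k"
        using powr_add[of "(1/2) ^ k" s 1]
        by (simp add: s_def powr_power powr_powr mult.commute flip: powr_realpow)
      then show ?thesis by (simp add: b_def mult_ac)
    qed
    have "summable (\<lambda>k. b k * (2 * pi * (1/2) ^ k))"
      unfolding eq using p by (intro summable_mult summable_geometric) (simp add: powr01_less_one)
    then have "(\<Sum>k. ennreal (b k * (2 * pi * (1/2) ^ k))) = ennreal (\<Sum>k. b k * (2 * pi * (1/2) ^ k))"
      using b by (intro suminf_ennreal2) auto
    then show ?thesis by simp
  qed
  finally show ?thesis by (simp add: s_def)
qed

lemma one_minus_cnj_mult_nonzero:
  assumes "b \<in> \<D>" "z \<in> \<D>"
  shows "1 - norm b \<le> norm (1 - cnj b * z)" "1 - cnj b * z \<noteq> 0"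
proof -
  have "norm (cnj b * z) \<le> norm b * 1"
    unfolding norm_mult complex_mod_cnj using assms by (intro mult_left_mono) auto
  then show "1 - norm b \<le> norm (1 - cnj b * z)" using norm_triangle_ineq2[of 1 "cnj b * z"] by simp
  then show "1 - cnj b * z \<noteq> 0" using assms by auto
qed

lemma one_minus_cnj_mult_self: "1 - cnj b * b = of_real (1 - (norm b)\<^sup>2)"
  using complex_norm_square[of b] by (simp add: mult.commute)

lemma norm_deriv_Moebius:
  assumes b: "b \<in> \<D>" and z: "z \<in> \<D>"
  shows "norm (deriv (Moebius_function 0 b) z) = (1 - (norm b)\<^sup>2) / (norm (1 - cnj b * z))\<^sup>2"
proof -
  note nz = one_minus_cnj_mult_nonzero(2)[OF b z]
  have "(Moebius_function 0 b has_field_derivative (1 - cnj b * b) / (1 - cnj b * z)\<^sup>2) (at z)"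
    unfolding Moebius_function_simple[abs_def]
    by (rule derivative_eq_intros refl nz)+ (simp add: power2_eq_square algebra_simps)
  then have "deriv (Moebius_function 0 b) z = (1 - cnj b * b) / (1 - cnj b * z)\<^sup>2"
    by (rule DERIV_imp_deriv)
  also have "1 - cnj b * b = of_real (1 - (norm b)\<^sup>2)"
    by (rule one_minus_cnj_mult_self)
  also have "norm (of_real (1 - (norm b)\<^sup>2) / (1 - cnj b * z)\<^sup>2) = \<bar>1 - (norm b)\<^sup>2\<bar> / (norm (1 - cnj b * z))\<^sup>2"
    by (simp only: norm_divide norm_power norm_of_real)
  also have "\<bar>1 - (norm b)\<^sup>2\<bar> = 1 - (norm b)\<^sup>2" using b by (simp add: abs_square_le_1 less_imp_le)
  finally show ?thesis .
qed

text \<open>Equality in the Schwarz-Pick inequality, from |1 - conj(b) z|^2 - |z-b|^2 =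
  (1-|z|^2)(1-|b|^2). It is the source of the conformal invariance of the Besov integral.\<close>

lemma one_minus_norm_Moebius_sq:
  assumes b: "b \<in> \<D>" and z: "z \<in> \<D>"
  shows "1 - (norm (Moebius_function 0 b z))\<^sup>2 = (1 - (norm z)\<^sup>2) * norm (deriv (Moebius_function 0 b) z)"
proof -
  have "(norm (z - b))\<^sup>2 + (1 - (norm z)\<^sup>2) * (1 - (norm b)\<^sup>2) = (norm (1 - cnj b * z))\<^sup>2"
    unfolding cmod_power2 by (simp add: power2_eq_square algebra_simps)
  then show ?thesis
    using one_minus_cnj_mult_nonzero(2)[OF b z]
    by (simp add: norm_deriv_Moebius[OF b z] Moebius_function_simple norm_divide power_divide field_simps)
qed

text \<open>Of |phi'|^p, the factor |phi'|^2 is the Jacobian, while |phi'|^(p-2) merges with the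
  weight into (1-|phi|^2)^(p-2) by the Schwarz-Pick identity. After the substitution the integral is
  at most that of (1-|w|^2)^(p-2) over the disc, whatever \<open>b\<close> is.\<close>

lemma besov_int_Moebius:
  assumes p: "1 < p"
  obtains K where "0 \<le> K" "\<And>b. b \<in> \<D> \<Longrightarrow> besov_int p (Moebius_function 0 b) \<le> ennreal K"
proof -
  define F where "F w = indicator \<D> w * (1 - (norm w)\<^sup>2) powr (p - 2)" for w :: complex
  define K0 where "K0 = (\<integral>\<^sup>+w. ennreal (F w) \<partial>lborel)"
  have K0: "K0 < \<infinity>" using disc_weight_integral_finite[OF p] by (simp add: K0_def F_def)
  have F_nonneg: "0 \<le> F w" for w by (simp add: F_def)
  have [measurable]: "\<D> \<in> sets borel" by simp
  have mF: "F \<in> borel_measurable borel" unfolding F_def by measurable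
  show ?thesis
  proof
    show "0 \<le> 2 powr \<bar>p - 2\<bar> * enn2real K0" by simp
    fix b assume b: "b \<in> \<D>"
    let ?\<phi> = "Moebius_function 0 b"
    have maps: "?\<phi> ` \<D> \<subseteq> \<D>" using b Moebius_function_norm_lt_1 by auto
    have hol: "?\<phi> holomorphic_on \<D>" using b by (intro Moebius_function_holomorphic) auto
    have inj: "inj_on ?\<phi> \<D>"
      by (rule inj_on_inverseI[of _ "Moebius_function 0 (- b)"])
         (use b in \<open>auto intro: Moebius_function_compose\<close>)
    have le: "(\<integral>\<^sup>+w. ennreal (indicator (?\<phi> ` \<D>) w * F w) \<partial>lborel) \<le> K0"
      unfolding K0_def by (intro nn_integral_mono ennreal_leI) (auto simp: indicator_def F_def)
    have "(\<integral>\<^sup>+z. ennreal (indicator \<D> z * ((norm (deriv ?\<phi> z))\<^sup>2 * F (?\<phi> z))) \<partial>lborel)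
       = (\<integral>\<^sup>+w. ennreal (indicator (?\<phi> ` \<D>) w * F w) \<partial>lborel)"
      using hol inj mF le K0
      by (intro nn_integral_holomorphic_substitution) (auto simp: F_def intro: le_less_trans)
    note cov = this le
    have "besov_int p ?\<phi> \<le> (\<integral>\<^sup>+z. ennreal (2 powr \<bar>p - 2\<bar>) * ennreal (indicator \<D> z * ((norm (deriv ?\<phi> z))\<^sup>2 * F (?\<phi> z))) \<partial>lborel)"
      unfolding besov_int_def
    proof (intro nn_integral_mono)
      fix z
      show "ennreal (besov_density p ?\<phi> z) \<le> ennreal (2 powr \<bar>p - 2\<bar>) * ennreal (indicator \<D> z * ((norm (deriv ?\<phi> z))\<^sup>2 * F (?\<phi> z)))"
      proof (cases "z \<in> \<D>")
        case True
        then have z: "norm z < 1" by simp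
        define t where "t = norm (deriv ?\<phi> z)"
        have t: "0 < t"
          using b True one_minus_cnj_mult_nonzero[OF b True]
          by (auto simp: t_def norm_deriv_Moebius[OF b True] abs_square_less_1)
        have tp: "t powr p = t powr (p - 2) * t\<^sup>2"
          using t powr_add[of t "p - 2" 2] by simp
        have sq: "0 < 1 - (norm z)\<^sup>2" using z by (simp add: abs_square_less_1)
        have "(1 - norm z) powr (p - 2) \<le> 2 powr \<bar>p - 2\<bar> * (1 - (norm z)\<^sup>2) powr (p - 2)"
          using one_minus_norm_sq_bounds[OF z] z by (intro powr_comparable) auto
        then have "(1 - norm z) powr (p - 2) * t powr p \<le> (2 powr \<bar>p - 2\<bar> * (1 - (norm z)\<^sup>2) powr (p - 2)) * t powr p"
          by (rule mult_right_mono) simp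
        also have "\<dots> = 2 powr \<bar>p - 2\<bar> * (t\<^sup>2 * ((1 - (norm z)\<^sup>2) * t) powr (p - 2))"
          using t sq by (simp add: powr_mult tp)
        also have "((1 - (norm z)\<^sup>2) * t) powr (p - 2) = F (?\<phi> z)"
        proof -
          have "?\<phi> z \<in> \<D>" using maps True by blast
          then show ?thesis unfolding F_def one_minus_norm_Moebius_sq[OF b True] t_def by simp
        qed
        finally show ?thesis
          using True F_nonneg by (simp add: besov_density_def t_def ennreal_leI flip: ennreal_mult)
      qed (simp add: besov_density_def)
    qed
    also have "\<dots> = ennreal (2 powr \<bar>p - 2\<bar>) * (\<integral>\<^sup>+z. ennreal (indicator \<D> z * ((norm (deriv ?\<phi> z))\<^sup>2 * F (?\<phi> z))) \<partial>lborel)"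
    proof (rule nn_integral_cmult)
      have [measurable]: "(\<lambda>z. indicator \<D> z *\<^sub>R deriv ?\<phi> z) \<in> borel_measurable borel"
        "(\<lambda>z. indicator \<D> z *\<^sub>R ?\<phi> z) \<in> borel_measurable borel"
        using hol by (auto intro!: borel_measurable_continuous_on_indicator holomorphic_on_imp_continuous_on holomorphic_deriv)
      note mF[measurable]
      have "(\<lambda>z. ennreal (indicator \<D> z * ((norm (indicator \<D> z *\<^sub>R deriv ?\<phi> z))\<^sup>2 * F (indicator \<D> z *\<^sub>R ?\<phi> z)))) \<in> borel_measurable lborel"
        by measurable
      also have "(\<lambda>z. ennreal (indicator \<D> z * ((norm (indicator \<D> z *\<^sub>R deriv ?\<phi> z))\<^sup>2 * F (indicator \<D> z *\<^sub>R ?\<phi> z))))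
         = (\<lambda>z. ennreal (indicator \<D> z * ((norm (deriv ?\<phi> z))\<^sup>2 * F (?\<phi> z))))"
        by (auto simp: indicator_def)
      finally show "\<dots> \<in> borel_measurable lborel" .
    qed
    also have "\<dots> \<le> ennreal (2 powr \<bar>p - 2\<bar>) * K0" using cov by (intro mult_left_mono) auto
    also have "\<dots> = ennreal (2 powr \<bar>p - 2\<bar> * enn2real K0)"
      using K0 by (simp add: ennreal_mult less_top[symmetric])
    finally show "besov_int p ?\<phi> \<le> ennreal (2 powr \<bar>p - 2\<bar> * enn2real K0)" .
  qed
qed

section \<open>Logarithmic test functions\<close>

text \<open>Choose k with h = (1/2)^k comparable to |1 - conj(b) z|. The point a = (1-h)e is within
  h of b, so |1 - conj(a) z| \<le> 3h, and the derivative at \<open>z\<close> is at least h/(3h)^2 =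
  1/(9h). Together with 1/|1 - conj(b) z| \<le> 2/h this gives 18 = 2 * 9.\<close>

lemma Moebius_deriv_dyadic_lower:
  assumes e: "norm e = 1" and r: "0 \<le> r" "r < 1" and z: "z \<in> \<D>"
    and n: "1 - r \<le> (1/2) ^ n" "(1/2) ^ n \<le> 2 * (1 - r)"
  shows "\<exists>k\<le>n. 1 / norm (1 - cnj (of_real r * e) * z)
    \<le> 18 * norm (deriv (Moebius_function 0 (of_real (1 - (1/2) ^ k) * e)) z)"
proof -
  define b where "b = of_real r * e"
  have b: "norm b = r" using e r by (simp add: b_def norm_mult)
  then have bD: "b \<in> \<D>" using r by simp
  define w where "w = norm (1 - cnj b * z)"
  have w: "1 - r \<le> w" "0 < w"
    using one_minus_cnj_mult_nonzero[OF bD z] b by (auto simp: w_def)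
  have "norm (cnj b * z) \<le> 1 * 1"
    unfolding norm_mult complex_mod_cnj b using r z by (intro mult_mono) auto
  then have w2: "w \<le> 2" unfolding w_def using norm_triangle_ineq4[of 1 "cnj b * z"] by simp
  \<comment> \<open>If \<open>w\<close> is near its lower bound 1-r, then \<open>k = n\<close>
    works. Otherwise \<open>k\<close> is the dyadic level of \<open>w / 2\<close>, which is at most
    1, and the failure of the first case keeps \<open>k\<close> at most \<open>n\<close>.\<close>
  obtain k where k: "k \<le> n" "w \<le> 2 * (1/2) ^ k" "(1/2) ^ k \<le> 2 * w"
  proof (cases "w \<le> 2 * (1/2) ^ n")
    case True
    then show ?thesis using that[of n] n w by auto
  next
    case False
    obtain k where k: "(1/2) ^ Suc k < w / 2" "w / 2 \<le> (1/2) ^ k"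
      using dyadic_level_exact[of "w / 2"] w w2 by auto
    have "k \<le> n"
    proof (rule ccontr)
      assume "\<not> k \<le> n"
      then have "(1/2::real) ^ k \<le> (1/2) ^ n" by (intro power_decreasing) auto
      then show False using False k(2) by argo
    qed
    then show ?thesis using that[of k] k w by auto
  qed
  define h where "h = (1/2::real) ^ k"
  have h: "0 < h" "h \<le> 1" by (auto simp: h_def power_le_one)
  have "(1/2::real) ^ n \<le> (1/2) ^ k" using k(1) by (intro power_decreasing) auto
  with n(1) have hn: "1 - r \<le> h" unfolding h_def by (rule order_trans)
  define a where "a = of_real (1 - h) * e"
  have a: "norm a = 1 - h" using e h by (simp add: a_def norm_mult del: of_real_diff)
  then have aD: "a \<in> \<D>" using h by simp
  have "b - a = of_real (r - (1 - h)) * e" by (simp add: b_def a_def algebra_simps)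
  then have "norm (b - a) = \<bar>r - (1 - h)\<bar>" using e by (simp add: norm_mult del: of_real_diff)
  then have "norm (b - a) \<le> h" using hn r h by linarith
  then have "norm (cnj (b - a) * z) \<le> h * 1"
    unfolding norm_mult complex_mod_cnj using z h by (intro mult_mono) auto
  moreover have "norm (1 - cnj a * z) \<le> w + norm (cnj (b - a) * z)"
    using norm_triangle_ineq[of "1 - cnj b * z" "cnj (b - a) * z"] by (simp add: w_def algebra_simps)
  ultimately have "norm (1 - cnj a * z) \<le> 3 * h" using k(2) by (simp add: h_def)
  then have sq: "(norm (1 - cnj a * z))\<^sup>2 \<le> 9 * h\<^sup>2"
    using power_mono[of "norm (1 - cnj a * z)" "3 * h" 2] by (simp add: power_mult_distrib)
  have pos: "0 < (norm (1 - cnj a * z))\<^sup>2" using one_minus_cnj_mult_nonzero(2)[OF aD z] by simp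
  have "1 / w \<le> 2 / h" using k(3) w h by (simp add: h_def field_simps)
  also have "\<dots> = 18 * (h / (9 * h\<^sup>2))" using h by (simp add: power2_eq_square field_simps)
  also have "\<dots> \<le> 18 * (h / (norm (1 - cnj a * z))\<^sup>2)"
    using sq pos h by (intro mult_left_mono divide_left_mono) auto
  also have "\<dots> \<le> 18 * ((1 - (norm a)\<^sup>2) / (norm (1 - cnj a * z))\<^sup>2)"
  proof -
    have "h * h \<le> h * 1" using h by (intro mult_left_mono) auto
    then have "h \<le> 1 - (norm a)\<^sup>2" unfolding a by (simp add: power2_eq_square algebra_simps)
    then show ?thesis by (intro mult_left_mono divide_right_mono) auto
  qed
  also have "\<dots> = 18 * norm (deriv (Moebius_function 0 a) z)"
    by (simp add: norm_deriv_Moebius[OF aD z])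
  finally show ?thesis using k(1) unfolding w_def a_def h_def b_def by blast
qed

text \<open>The difference of logarithms is the branch of log(2/(1 - conj(b) z)) that is holomorphic
  on the disc, where 1 - conj(b) z has positive real part. At \<open>z = b\<close> it equals the
  logarithm L of the prefactor, so the function takes the value L^(1-1/p), the weight of
  \<open>Bloch_log (1 - 1 / p)\<close>.\<close>

definition log_test :: "real \<Rightarrow> complex \<Rightarrow> complex \<Rightarrow> complex" where
  "log_test p b z = of_real (ln (2 / (1 - (norm b)\<^sup>2)) powr (- 1 / p)) * (of_real (ln 2) - Ln (1 - cnj b * z))"

lemma log_test_has_deriv:
  assumes b: "b \<in> \<D>" and z: "z \<in> \<D>"
  shows "(log_test p b has_field_derivative
      of_real (ln (2 / (1 - (norm b)\<^sup>2)) powr (- 1 / p)) * (cnj b / (1 - cnj b * z))) (at z)"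
proof -
  have "norm (cnj b * z) < 1"
    unfolding norm_mult complex_mod_cnj using b z mult_strict_mono'[of "norm b" 1 "norm z" 1] by simp
  then have "0 < Re (1 - cnj b * z)" using complex_Re_le_cmod[of "cnj b * z"] by simp
  then have "1 - cnj b * z \<notin> \<real>\<^sub>\<le>\<^sub>0" using complex_nonpos_Reals_iff by force
  then show ?thesis unfolding log_test_def[abs_def]
    by (auto intro!: derivative_eq_intros simp: divide_simps)
qed

lemma log_test_holomorphic:
  assumes "b \<in> \<D>"
  shows "log_test p b holomorphic_on \<D>"
  using log_test_has_deriv[OF assms] unfolding holomorphic_on_open[OF open_ball] by blast

lemma log_test_diagonal:
  assumes b: "b \<in> \<D>"
  shows "log_test p b b = of_real (ln (2 / (1 - (norm b)\<^sup>2)) powr (1 - 1 / p))"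
proof -
  define L where "L = ln (2 / (1 - (norm b)\<^sup>2))"
  have sq: "0 < 1 - (norm b)\<^sup>2" using b by (simp add: abs_square_less_1)
  have L: "0 < L" using log_weight_ge(1)[OF b] by (auto simp: L_def intro: less_le_trans[of 0 "ln 2"])
  have "of_real (ln 2) - Ln (1 - cnj b * b) = of_real (ln 2 - ln (1 - (norm b)\<^sup>2))"
    unfolding one_minus_cnj_mult_self by (subst Ln_of_real) (use sq in auto)
  also have "ln 2 - ln (1 - (norm b)\<^sup>2) = L" using sq by (simp add: L_def ln_div)
  finally have "log_test p b b = of_real (L powr (- 1 / p) * L)"
    by (simp add: log_test_def L_def)
  also have "L powr (- 1 / p) * L = L powr (1 - 1 / p)"
    using L powr_add[of L "- 1 / p" 1] by (simp add: algebra_simps)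
  finally show ?thesis by (simp add: L_def)
qed

text \<open>For |z| \<le> r the modulus of 1 - conj(b) z stays between 1-r and 2, uniformly in
  \<open>b\<close>, and the prefactor is largest where its logarithm takes the smallest value,
  \<open>ln 2\<close>.\<close>

lemma log_test_locally_bounded:
  assumes p: "1 \<le> p" and r: "r < 1"
  shows "\<exists>M. \<forall>b\<in>\<D>. \<forall>z. norm z \<le> r \<longrightarrow> norm (log_test p b z) \<le> M"
proof (intro exI ballI allI impI)
  fix b z :: complex assume b: "b \<in> \<D>" and z: "norm z \<le> r"
  then have zD: "z \<in> \<D>" using r by simp
  let ?w = "1 - cnj b * z"
  have nz: "?w \<noteq> 0" by (rule one_minus_cnj_mult_nonzero(2)[OF b zD])
  have le: "norm (cnj b * z) \<le> 1 * r"
    unfolding norm_mult complex_mod_cnj using b z by (intro mult_mono) auto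
  then have w: "1 - r \<le> norm ?w" "norm ?w \<le> 2"
    using norm_triangle_ineq2[of 1 "cnj b * z"] norm_triangle_ineq4[of 1 "cnj b * z"] r by auto
  have "\<bar>Re (Ln ?w)\<bar> \<le> ln 2 + \<bar>ln (1 - r)\<bar>"
  proof -
    have "ln (norm ?w) \<le> ln 2" "ln (1 - r) \<le> ln (norm ?w)" using w r nz by auto
    moreover have "0 < ln (2::real)" by simp
    ultimately show ?thesis unfolding Re_Ln[OF nz] by linarith
  qed
  moreover have "\<bar>Im (Ln ?w)\<bar> \<le> pi" using mpi_less_Im_Ln[OF nz] Im_Ln_le_pi[OF nz] by linarith
  ultimately have "norm (Ln ?w) \<le> ln 2 + \<bar>ln (1 - r)\<bar> + pi"
    using cmod_le[of "Ln ?w"] by linarith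
  moreover have "norm (of_real (ln 2) :: complex) = ln 2" by (simp only: norm_of_real) simp
  ultimately have "norm (of_real (ln 2) - Ln ?w) \<le> ln 2 + (ln 2 + \<bar>ln (1 - r)\<bar> + pi)"
    using norm_triangle_ineq4[of "of_real (ln 2)" "Ln ?w"] by linarith
  moreover have "ln (2 / (1 - (norm b)\<^sup>2)) powr (- 1 / p) \<le> ln 2 powr (- 1 / p)"
    using log_weight_ge(1)[OF b] p by (intro powr_mono2') auto
  ultimately show "norm (log_test p b z) \<le> ln 2 powr (- 1 / p) * (ln 2 + (ln 2 + \<bar>ln (1 - r)\<bar> + pi))"
    unfolding log_test_def norm_mult by (intro mult_mono) auto
qed

text \<open>The largest of the n+1 Moebius densities is replaced by their sum, so the bound is
  (n+1)/L times a constant. It remains bounded because (1/2)^n \<ge> 1-r forces n+1 \<le> (2 / ln 2)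
  L.\<close>

lemma besov_int_log_test:
  assumes p: "1 < p"
  obtains K where "\<And>b. b \<in> \<D> \<Longrightarrow> besov_int p (log_test p b) \<le> ennreal K"
proof -
  obtain K where K: "0 \<le> K" "\<And>b. b \<in> \<D> \<Longrightarrow> besov_int p (Moebius_function 0 b) \<le> ennreal K"
    using besov_int_Moebius[OF p] by blast
  show ?thesis
  proof
    fix b assume b: "b \<in> \<D>"
    define r where "r = norm b"
    have r: "0 \<le> r" "r < 1" using b by (auto simp: r_def)
    define L where "L = ln (2 / (1 - (norm b)\<^sup>2))"
    have L: "ln 2 \<le> L" "ln (1 / (1 - r)) \<le> L" using log_weight_ge[OF b] by (auto simp: L_def r_def)
    have L0: "0 < L" by (rule less_le_trans[OF _ L(1)]) simp
    obtain e where e: "norm e = 1" "b = of_real r * e"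
    proof (cases "b = 0")
      case True
      then show ?thesis by (intro that[of 1]) (auto simp: r_def)
    next
      case False
      then show ?thesis by (intro that[of "b / of_real (norm b)"]) (auto simp: norm_divide r_def)
    qed
    obtain n where n: "(1/2) ^ Suc n < 1 - r" "1 - r \<le> (1/2) ^ n"
      using dyadic_level_exact[of "1 - r"] r by auto
    have "real (Suc n) \<le> 2 / ln 2 * L"
    proof -
      have "2 ^ n \<le> 1 / (1 - r)" using n(2) r by (simp add: power_one_over field_simps)
      then have "ln (2 ^ n) \<le> ln (1 / (1 - r))" by (rule ln_mono) (use r in auto)
      then have "real n * ln 2 \<le> L" using L(2) by (simp add: ln_realpow)
      then have "real (Suc n) * ln 2 \<le> 2 * L" using L(1) by (simp add: algebra_simps)
      then show ?thesis by (simp add: field_simps)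
    qed
    note nL = this
    define a where "a k = of_real (1 - (1/2) ^ k) * e" for k :: nat
    have a: "a k \<in> \<D>" for k
    proof -
      have "norm (a k) = 1 - (1/2) ^ k"
        using e by (simp add: a_def norm_mult power_le_one del: of_real_diff)
      then show ?thesis by simp
    qed
    have pw: "besov_density p (log_test p b) z \<le> 18 powr p / L * (\<Sum>k<Suc n. besov_density p (Moebius_function 0 (a k)) z)" for z
    proof (cases "z \<in> \<D>")
      case True
      obtain k where k: "k \<le> n" "1 / norm (1 - cnj b * z) \<le> 18 * norm (deriv (Moebius_function 0 (a k)) z)"
        using Moebius_deriv_dyadic_lower[OF e(1) r True n(2)] n(1) unfolding a_def e(2)[symmetric] by auto
      have "norm (deriv (log_test p b) z) = L powr (- 1 / p) * (r / norm (1 - cnj b * z))"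
        unfolding DERIV_imp_deriv[OF log_test_has_deriv[OF b True]]
        by (simp add: norm_mult norm_divide L_def r_def)
      also have "\<dots> \<le> L powr (- 1 / p) * (18 * norm (deriv (Moebius_function 0 (a k)) z))"
        using r by (intro mult_left_mono order_trans[OF divide_right_mono k(2)]) auto
      finally have "norm (deriv (log_test p b) z) powr p \<le> (L powr (- 1 / p) * (18 * norm (deriv (Moebius_function 0 (a k)) z))) powr p"
        using p by (intro powr_mono2) auto
      also have "\<dots> = 18 powr p / L * norm (deriv (Moebius_function 0 (a k)) z) powr p"
      proof -
        have "(L powr (- 1 / p)) powr p = 1 / L"
          unfolding powr_powr using p L0 by (simp add: powr_minus_divide)
        then show ?thesis unfolding powr_mult by simp
      qed
      finally have "besov_density p (log_test p b) z \<le> (1 - norm z) powr (p - 2) * (18 powr p / L * norm (deriv (Moebius_function 0 (a k)) z) powr p)"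
        using True unfolding besov_density_def by (simp add: mult_left_mono del: times_divide_eq_right times_divide_eq_left)
      also have "\<dots> = 18 powr p / L * besov_density p (Moebius_function 0 (a k)) z"
        using True by (simp add: besov_density_def)
      also have "\<dots> \<le> 18 powr p / L * (\<Sum>k<Suc n. besov_density p (Moebius_function 0 (a k)) z)"
        using L0 k(1) by (intro mult_left_mono member_le_sum besov_density_nonneg) auto
      finally show ?thesis .
    qed (simp add: besov_density_def)
    have [measurable]: "besov_density p (Moebius_function 0 (a k)) \<in> borel_measurable borel" for k
      using a[of k] by (intro borel_measurable_besov_density Moebius_function_holomorphic) simp
    have "besov_int p (log_test p b) \<le> (\<integral>\<^sup>+z. ennreal (18 powr p / L) * (\<Sum>k<Suc n. ennreal (besov_density p (Moebius_function 0 (a k)) z)) \<partial>lborel)"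
      unfolding besov_int_def
    proof (intro nn_integral_mono)
      fix z
      have "ennreal (besov_density p (log_test p b) z) \<le> ennreal (18 powr p / L * (\<Sum>k<Suc n. besov_density p (Moebius_function 0 (a k)) z))"
        by (rule ennreal_leI[OF pw])
      also have "\<dots> = ennreal (18 powr p / L) * (\<Sum>k<Suc n. ennreal (besov_density p (Moebius_function 0 (a k)) z))"
        unfolding sum_ennreal[OF besov_density_nonneg] using L0
        by (intro ennreal_mult sum_nonneg besov_density_nonneg) auto
      finally show "ennreal (besov_density p (log_test p b) z) \<le> \<dots>" .
    qed
    also have "\<dots> = ennreal (18 powr p / L) * (\<Sum>k<Suc n. besov_int p (Moebius_function 0 (a k)))"
    proof -
      have "(\<integral>\<^sup>+z. (\<Sum>k<Suc n. ennreal (besov_density p (Moebius_function 0 (a k)) z)) \<partial>lborel)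
          = (\<Sum>k<Suc n. besov_int p (Moebius_function 0 (a k)))"
        unfolding besov_int_def by (rule nn_integral_sum) measurable
      moreover have m: "(\<lambda>z. \<Sum>k<Suc n. ennreal (besov_density p (Moebius_function 0 (a k)) z)) \<in> borel_measurable lborel"
        by measurable
      ultimately show ?thesis by (simp only: nn_integral_cmult[OF m])
    qed
    also have "\<dots> \<le> ennreal (18 powr p / L) * (\<Sum>k<Suc n. ennreal K)"
      using K(2) a by (intro mult_left_mono sum_mono) auto
    also have "\<dots> = ennreal (18 powr p / L * (real (Suc n) * K))"
    proof -
      have "(\<Sum>k<Suc n. ennreal K) = ennreal (real (Suc n) * K)"
        using K(1) by (subst sum_ennreal) auto
      then show ?thesis using L0 K(1) by (simp only:) (rule ennreal_mult[symmetric], auto)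
    qed
    also have "\<dots> \<le> ennreal (18 powr p * (2 / ln 2) * K)"
    proof (rule ennreal_leI)
      have "18 powr p / L * (real (Suc n) * K) \<le> 18 powr p / L * ((2 / ln 2 * L) * K)"
        using nL K(1) L0 by (intro mult_left_mono mult_right_mono) auto
      also have "\<dots> = 18 powr p * (2 / ln 2) * K" using L0 by simp
      finally show "18 powr p / L * (real (Suc n) * K) \<le> 18 powr p * (2 / ln 2) * K" .
    qed
    finally show "besov_int p (log_test p b) \<le> ennreal (18 powr p * (2 / ln 2) * K)" .
  qed
qed

section \<open>Uniform bounds on families of test functions\<close>

text \<open>\<open>gliding_hump\<close> with the points \<open>z\<close> as rows and the parameters
  \<open>b\<close> as columns. For fixed \<open>z\<close> a row is bounded by local boundedness and
  Cauchy's estimate. The form u f + v f' covers the derivatives of all three operators, with weights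
  absorbed into \<open>u\<close> and \<open>v\<close>.\<close>

lemma Besov_uniform_bound:
  assumes p: "1 \<le> p"
    and op: "\<And>f. f \<in> Besov p \<Longrightarrow> \<exists>B. \<forall>z\<in>\<D>. norm (u z * f z + v z * deriv f z) \<le> B"
    and hol: "\<And>b. b \<in> I \<Longrightarrow> h b holomorphic_on \<D>"
    and K: "\<And>b. b \<in> I \<Longrightarrow> besov_int p (h b) \<le> ennreal K"
    and loc: "\<And>r. r < 1 \<Longrightarrow> \<exists>M. \<forall>b\<in>I. \<forall>z. norm z \<le> r \<longrightarrow> norm (h b z) \<le> M"
  shows "\<exists>B. \<forall>z\<in>\<D>. \<forall>b\<in>I. norm (u z * h b z + v z * deriv (h b) z) \<le> B"
proof (rule gliding_hump)
  fix z :: complex assume z: "z \<in> \<D>"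
  obtain M1 where M1: "\<And>b. b \<in> I \<Longrightarrow> norm (h b z) \<le> M1"
    using loc[of "norm z"] z by auto
  obtain M2 where M2: "\<And>b. b \<in> I \<Longrightarrow> norm (deriv (h b) z) \<le> M2"
    using locally_bounded_imp_deriv_bounded[OF hol loc z] by blast
  have "norm (u z * h b z + v z * deriv (h b) z) \<le> norm (u z) * M1 + norm (v z) * M2" if "b \<in> I" for b
    using M1[OF that] M2[OF that]
    by (intro order_trans[OF norm_triangle_ineq]) (auto simp: norm_mult intro!: add_mono mult_left_mono)
  then show "\<exists>K. \<forall>b\<in>I. norm (u z * h b z + v z * deriv (h b) z) \<le> K" by blast
next
  fix c :: "nat \<Rightarrow> complex" and m :: "nat \<Rightarrow> 'a"
  assume m: "\<And>k. m k \<in> I" and c: "\<And>k. norm (c k) = (1/3) ^ k"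
  have loc': "\<exists>M. \<forall>k z. norm z \<le> r \<longrightarrow> norm (h (m k) z) \<le> M" if "r < 1" for r
    using loc[OF that] m by blast
  obtain F where F: "F \<in> Besov p"
    "\<And>z. z \<in> \<D> \<Longrightarrow> (\<lambda>k. c k * h (m k) z) sums F z"
    "\<And>z. z \<in> \<D> \<Longrightarrow> (\<lambda>k. c k * deriv (h (m k)) z) sums deriv F z"
    using Besov_series[where f = "\<lambda>k. h (m k)", OF p hol[OF m] K[OF m] loc' c] by blast
  have "(\<Sum>k. c k * (u z * h (m k) z + v z * deriv (h (m k)) z)) = u z * F z + v z * deriv F z" if "z \<in> \<D>" for z
  proof -
    have "(\<lambda>k. u z * (c k * h (m k) z) + v z * (c k * deriv (h (m k)) z)) sums (u z * F z + v z * deriv F z)"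
      using F(2,3)[OF that] by (intro sums_add sums_mult)
    then show ?thesis by (simp add: sums_iff algebra_simps)
  qed
  then show "\<exists>B. \<forall>z\<in>\<D>. norm (\<Sum>k. c k * (u z * h (m k) z + v z * deriv (h (m k)) z)) \<le> B"
    using op[OF F(1)] by simp
qed

section \<open>The three operators\<close>

lemma contour_integral_linepath_has_deriv:
  assumes "\<phi> holomorphic_on \<D>" and z: "z \<in> \<D>"
  shows "((\<lambda>z. contour_integral (linepath 0 z) \<phi>) has_field_derivative \<phi> z) (at z)"
proof -
  obtain G where G: "\<And>x. x \<in> \<D> \<Longrightarrow> (G has_field_derivative \<phi> x) (at x within \<D>)"
    using holomorphic_convex_primitive'[OF convex_ball open_ball assms(1)] by blast
  have "contour_integral (linepath 0 w) \<phi> = G w - G 0" if "w \<in> \<D>" for w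
  proof -
    have "closed_segment 0 w \<subseteq> \<D>" using that by (intro closed_segment_subset convex_ball) auto
    from contour_integral_primitive[OF G valid_path_linepath, of 0 w] this
    show ?thesis by (intro contour_integral_unique) simp
  qed
  moreover have der: "((\<lambda>w. G w - G 0) has_field_derivative \<phi> z) (at z)"
    using G[OF z] z by (auto intro!: derivative_eq_intros simp: at_within_open[OF z])
  ultimately show ?thesis
    by (intro has_field_derivative_transform_within_open[OF der open_ball z]) simp
qed

text \<open>The Bloch condition as a property of the derivative alone, so that I_g, T_g and M_g can
  be compared by adding their derivatives.\<close>

definition bloch_bounded :: "(complex \<Rightarrow> complex) \<Rightarrow> bool" where
  "bloch_bounded \<phi> \<longleftrightarrow> (\<exists>B. \<forall>z\<in>\<D>. (1 - (norm z)\<^sup>2) * norm (\<phi> z) \<le> B)"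

lemma bloch_bounded_add:
  assumes "bloch_bounded \<phi>" "bloch_bounded \<psi>"
  shows "bloch_bounded (\<lambda>z. \<phi> z + \<psi> z)"
proof -
  obtain A B where AB: "\<And>z. z \<in> \<D> \<Longrightarrow> (1 - (norm z)\<^sup>2) * norm (\<phi> z) \<le> A"
      "\<And>z. z \<in> \<D> \<Longrightarrow> (1 - (norm z)\<^sup>2) * norm (\<psi> z) \<le> B"
    using assms unfolding bloch_bounded_def by blast
  have "(1 - (norm z)\<^sup>2) * norm (\<phi> z + \<psi> z) \<le> A + B" if z: "z \<in> \<D>" for z
  proof -
    have "(1 - (norm z)\<^sup>2) * norm (\<phi> z + \<psi> z) \<le> (1 - (norm z)\<^sup>2) * (norm (\<phi> z) + norm (\<psi> z))"
      using one_minus_norm_sq_pos[OF z] by (intro mult_left_mono norm_triangle_ineq) auto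
    then show ?thesis using AB[OF z] by (simp add: distrib_left)
  qed
  then show ?thesis unfolding bloch_bounded_def by blast
qed

lemma bloch_bounded_uminus: "bloch_bounded \<phi> \<Longrightarrow> bloch_bounded (\<lambda>z. - \<phi> z)"
  by (simp add: bloch_bounded_def)

lemma Bloch_iff:
  assumes "\<And>z. z \<in> \<D> \<Longrightarrow> (F has_field_derivative \<phi> z) (at z)"
  shows "F \<in> Bloch \<longleftrightarrow> bloch_bounded \<phi>"
proof -
  have "F holomorphic_on \<D>" using assms unfolding holomorphic_on_open[OF open_ball] by blast
  moreover have "deriv F z = \<phi> z" if "z \<in> \<D>" for z using assms[OF that] by (rule DERIV_imp_deriv)
  ultimately show ?thesis by (auto simp: Bloch_def bloch_bounded_def bdd_above_def)
qed

lemma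
  assumes g: "g holomorphic_on \<D>" and f: "f holomorphic_on \<D>"
  shows I_op_Bloch_iff: "I_op g f \<in> Bloch \<longleftrightarrow> bloch_bounded (\<lambda>z. g z * deriv f z)"
    and T_op_Bloch_iff: "T_op g f \<in> Bloch \<longleftrightarrow> bloch_bounded (\<lambda>z. deriv g z * f z)"
    and M_op_Bloch_iff: "M_op g f \<in> Bloch \<longleftrightarrow> bloch_bounded (\<lambda>z. deriv g z * f z + g z * deriv f z)"
proof -
  have "deriv f holomorphic_on \<D>" "deriv g holomorphic_on \<D>"
    using f g by (auto intro: holomorphic_deriv)
  then have "(\<lambda>z. g z * deriv f z) holomorphic_on \<D>" "(\<lambda>z. deriv g z * f z) holomorphic_on \<D>"
    using f g by (auto intro: holomorphic_on_mult)
  note primitive = this[THEN contour_integral_linepath_has_deriv]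
  show "I_op g f \<in> Bloch \<longleftrightarrow> bloch_bounded (\<lambda>z. g z * deriv f z)"
    unfolding I_op_def[abs_def] by (rule Bloch_iff) (rule primitive(1))
  show "T_op g f \<in> Bloch \<longleftrightarrow> bloch_bounded (\<lambda>z. deriv g z * f z)"
    unfolding T_op_def[abs_def] by (rule Bloch_iff) (rule primitive(2))
  show "M_op g f \<in> Bloch \<longleftrightarrow> bloch_bounded (\<lambda>z. deriv g z * f z + g z * deriv f z)"
    unfolding M_op_def[abs_def]
    using holomorphic_derivI[OF f open_ball] holomorphic_derivI[OF g open_ball]
    by (intro Bloch_iff) (auto intro!: derivative_eq_intros)
qed

text \<open>The weight is moved into the coefficients \<open>u\<close> and \<open>v\<close>; the
  bound, uniform in the point and in the parameter, is then read off on the diagonal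
  \<open>b = z\<close>.\<close>

lemma bloch_bounded_uniform:
  assumes p: "1 \<le> p"
    and op: "\<And>f. f \<in> Besov p \<Longrightarrow> bloch_bounded (\<lambda>z. u z * f z + v z * deriv f z)"
    and h: "\<And>b. b \<in> \<D> \<Longrightarrow> h b holomorphic_on \<D>"
      "\<And>b. b \<in> \<D> \<Longrightarrow> besov_int p (h b) \<le> ennreal K"
      "\<And>r. r < 1 \<Longrightarrow> \<exists>M. \<forall>b\<in>\<D>. \<forall>z. norm z \<le> r \<longrightarrow> norm (h b z) \<le> M"
  shows "\<exists>B. \<forall>z\<in>\<D>. (1 - (norm z)\<^sup>2) * norm (u z * h z z + v z * deriv (h z) z) \<le> B"
proof -
  let ?w = "\<lambda>z. of_real (1 - (norm z)\<^sup>2) :: complex"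
  have w: "norm (?w z * u z * x + ?w z * v z * y) = (1 - (norm z)\<^sup>2) * norm (u z * x + v z * y)" if "z \<in> \<D>" for x y z
  proof -
    have "?w z * u z * x + ?w z * v z * y = ?w z * (u z * x + v z * y)" by (simp add: distrib_left mult.assoc)
    then have "norm (?w z * u z * x + ?w z * v z * y) = norm (?w z) * norm (u z * x + v z * y)"
      by (simp only: norm_mult)
    also have "norm (?w z) = 1 - (norm z)\<^sup>2"
      unfolding norm_of_real using one_minus_norm_sq_pos[OF that] by simp
    finally show ?thesis .
  qed
  have "\<exists>B. \<forall>z\<in>\<D>. \<forall>b\<in>\<D>. norm (?w z * u z * h b z + ?w z * v z * deriv (h b) z) \<le> B"
  proof (rule Besov_uniform_bound[OF p _ h])
    fix f assume "f \<in> Besov p"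
    then show "\<exists>B. \<forall>z\<in>\<D>. norm (?w z * u z * f z + ?w z * v z * deriv f z) \<le> B"
      using op w by (simp add: bloch_bounded_def)
  qed
  then show ?thesis using w by (metis (no_types, lifting))
qed

lemma H_infinity_iff:
  assumes "g holomorphic_on \<D>"
  shows "g \<in> H_infinity \<longleftrightarrow> (\<exists>B. \<forall>z\<in>\<D>. norm (g z) \<le> B)"
  using assms by (auto simp: H_infinity_def bounded_iff)

text \<open>On the diagonal the term with \<open>u\<close> vanishes, and the Schwarz-Pick identity
  makes (1-|z|^2)|phi_z'(z)| equal to 1, so exactly |g(z)| remains. As \<open>u\<close> is
  arbitrary, the lemma serves I_g with \<open>u = 0\<close> and M_g with
  \<open>u = deriv g\<close>.\<close>

lemma H_infinity_of_Moebius_test: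
  assumes p: "1 < p" and g: "g holomorphic_on \<D>"
    and op: "\<And>f. f \<in> Besov p \<Longrightarrow> bloch_bounded (\<lambda>z. u z * f z + g z * deriv f z)"
  shows "g \<in> H_infinity"
proof -
  obtain K where K: "\<And>b. b \<in> \<D> \<Longrightarrow> besov_int p (Moebius_function 0 b) \<le> ennreal K"
    using besov_int_Moebius[OF p] by blast
  have "\<exists>B. \<forall>z\<in>\<D>. (1 - (norm z)\<^sup>2) * norm (u z * Moebius_function 0 z z + g z * deriv (Moebius_function 0 z) z) \<le> B"
  proof (rule bloch_bounded_uniform[OF _ op])
    show "\<exists>M. \<forall>b\<in>\<D>. \<forall>z. norm z \<le> r \<longrightarrow> norm (Moebius_function 0 b z) \<le> M" if "r < 1" for r
      by (intro exI[of _ 1] ballI allI impI less_imp_le Moebius_function_norm_lt_1) (use that in auto)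
  qed (use p K in \<open>auto intro: Moebius_function_holomorphic\<close>)
  moreover have "(1 - (norm z)\<^sup>2) * norm (u z * Moebius_function 0 z z + g z * deriv (Moebius_function 0 z) z) = norm (g z)"
    if z: "z \<in> \<D>" for z
    using one_minus_norm_Moebius_sq[OF z z] by (simp add: Moebius_function_eq_zero norm_mult)
  ultimately show ?thesis using H_infinity_iff[OF g] by auto
qed

lemma Bloch_log_of_log_test:
  assumes p: "1 < p" and g: "g holomorphic_on \<D>"
    and op: "\<And>f. f \<in> Besov p \<Longrightarrow> bloch_bounded (\<lambda>z. deriv g z * f z)"
  shows "g \<in> Bloch_log (1 - 1 / p)"
proof -
  obtain K where K: "\<And>b. b \<in> \<D> \<Longrightarrow> besov_int p (log_test p b) \<le> ennreal K"
    using besov_int_log_test[OF p] by blast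
  \<comment> \<open>The summand with coefficient 0 only brings g' f into the form u f + v
    f'.\<close>
  have "\<exists>B. \<forall>z\<in>\<D>. (1 - (norm z)\<^sup>2) * norm (deriv g z * log_test p z z + 0 * deriv (log_test p z) z) \<le> B"
    by (rule bloch_bounded_uniform[of p _ _ "log_test p" K])
       (use p K op log_test_holomorphic log_test_locally_bounded in auto)
  then show ?thesis
    using g by (auto simp: Bloch_log_def bdd_above_def log_test_diagonal norm_mult mult_ac)
qed

lemma Bloch_log_imp_bloch_bounded:
  assumes p: "1 \<le> p" and g: "g \<in> Bloch_log (1 - 1 / p)" and f: "f \<in> Besov p"
  shows "bloch_bounded (\<lambda>z. deriv g z * f z)"
proof -
  let ?L = "\<lambda>z::complex. ln (2 / (1 - (norm z)\<^sup>2)) powr (1 - 1 / p)"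
  obtain C where C: "0 \<le> C" "\<And>z. z \<in> \<D> \<Longrightarrow> norm (f z) \<le> C * ?L z"
    using Besov_growth[OF f p] by blast
  obtain B where B: "\<And>z. z \<in> \<D> \<Longrightarrow> (1 - (norm z)\<^sup>2) * ?L z * norm (deriv g z) \<le> B"
    using g unfolding Bloch_log_def bdd_above_def by blast
  have "(1 - (norm z)\<^sup>2) * norm (deriv g z * f z) \<le> C * B" if z: "z \<in> \<D>" for z
  proof -
    have "(1 - (norm z)\<^sup>2) * norm (deriv g z * f z) = (1 - (norm z)\<^sup>2) * norm (deriv g z) * norm (f z)"
      by (simp add: norm_mult)
    also have "\<dots> \<le> (1 - (norm z)\<^sup>2) * norm (deriv g z) * (C * ?L z)"
      using C(2)[OF z] one_minus_norm_sq_pos[OF z] by (intro mult_left_mono) auto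
    also have "\<dots> = C * ((1 - (norm z)\<^sup>2) * ?L z * norm (deriv g z))" by (simp only: mult_ac)
    also have "\<dots> \<le> C * B" using B[OF z] C(1) by (intro mult_left_mono)
    finally show ?thesis .
  qed
  then show ?thesis unfolding bloch_bounded_def by blast
qed

lemma H_infinity_imp_bloch_bounded:
  assumes p: "1 \<le> p" and g: "g \<in> H_infinity" and f: "f \<in> Besov p"
  shows "bloch_bounded (\<lambda>z. g z * deriv f z)"
proof -
  obtain K where K: "\<And>z. z \<in> \<D> \<Longrightarrow> (1 - (norm z)\<^sup>2) * norm (deriv f z) \<le> K"
    using Besov_imp_bounded[OF f p] by blast
  obtain B where B: "\<And>z. z \<in> \<D> \<Longrightarrow> norm (g z) \<le> B"
    using g unfolding H_infinity_def bounded_iff by blast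
  have "(1 - (norm z)\<^sup>2) * norm (g z * deriv f z) \<le> B * K" if z: "z \<in> \<D>" for z
  proof -
    have "(1 - (norm z)\<^sup>2) * norm (g z * deriv f z) = norm (g z) * ((1 - (norm z)\<^sup>2) * norm (deriv f z))"
      by (simp add: norm_mult)
    also have "\<dots> \<le> B * K"
      using K[OF z] B[OF z] one_minus_norm_sq_pos[OF z] order_trans[OF norm_ge_zero B[OF z]]
      by (intro mult_mono) auto
    finally show ?thesis .
  qed
  then show ?thesis unfolding bloch_bounded_def by blast
qed

theorem theorem2p2:
  fixes p p' :: real and g :: "complex \<Rightarrow> complex"
  assumes "1 < p" and "1 / p + 1 / p' = 1"
    and "g holomorphic_on \<D>"
  shows "(I_op g ` Besov p \<subseteq> Bloch \<longleftrightarrow> g \<in> H_infinity)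
       \<and> (M_op g ` Besov p \<subseteq> Bloch \<longleftrightarrow> g \<in> H_infinity \<inter> Bloch_log (1 / p'))
       \<and> (T_op g ` Besov p \<subseteq> Bloch \<longleftrightarrow> g \<in> Bloch_log (1 / p'))"
proof -
  note p = \<open>1 < p\<close> and g = \<open>g holomorphic_on \<D>\<close>
  have p': "1 / p' = 1 - 1 / p" using assms(2) by simp
  have hol: "f holomorphic_on \<D>" if "f \<in> Besov p" for f
    using that by (simp add: Besov_iff)
  let ?I = "\<forall>f\<in>Besov p. bloch_bounded (\<lambda>z. g z * deriv f z)"
  let ?T = "\<forall>f\<in>Besov p. bloch_bounded (\<lambda>z. deriv g z * f z)"
  let ?M = "\<forall>f\<in>Besov p. bloch_bounded (\<lambda>z. deriv g z * f z + g z * deriv f z)"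
  have sets: "I_op g ` Besov p \<subseteq> Bloch \<longleftrightarrow> ?I" "T_op g ` Besov p \<subseteq> Bloch \<longleftrightarrow> ?T"
     "M_op g ` Besov p \<subseteq> Bloch \<longleftrightarrow> ?M"
    using hol I_op_Bloch_iff[OF g] T_op_Bloch_iff[OF g] M_op_Bloch_iff[OF g] by auto
  have I: "?I \<longleftrightarrow> g \<in> H_infinity"
    using H_infinity_of_Moebius_test[OF p g, of "\<lambda>_. 0"] H_infinity_imp_bloch_bounded[of p g] p by auto
  have T: "?T \<longleftrightarrow> g \<in> Bloch_log (1 / p')"
    unfolding p' using Bloch_log_of_log_test[OF p g] Bloch_log_imp_bloch_bounded[of p g] p by auto
  \<comment> \<open>The Moebius test bounds \<open>g\<close> even in the presence of the term g' f.
    Then g f' is bounded in the Bloch sense, and subtracting it from the derivative of g f leaves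
    the condition for T_g.\<close>
  have "?I \<and> ?T" if M: ?M
  proof -
    have gH: "g \<in> H_infinity" using H_infinity_of_Moebius_test[OF p g, of "deriv g"] M by auto
    have "bloch_bounded (\<lambda>z. deriv g z * f z)" if f: "f \<in> Besov p" for f
    proof -
      have "bloch_bounded (\<lambda>z. - (g z * deriv f z))"
        using H_infinity_imp_bloch_bounded[OF _ gH f] p by (intro bloch_bounded_uminus) auto
      from bloch_bounded_add[OF M[rule_format, OF f] this] show ?thesis by simp
    qed
    then show ?thesis using I gH by blast
  qed
  moreover have ?M if ?I ?T
    using that by (auto intro: bloch_bounded_add)
  ultimately show ?thesis using I T sets by blast
qed

end
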